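(* Let $n_1\le n_2$, let $\Phi:\mathbb{R}^{n_1\times n_2}\to\mathbb{R}^m$ be a linear operator, $M_0\in\mathbb{R}^m$, and let $X_0$ be an optimal solution of the nuclear norm minimization problem $$\min_{X\in\mathbb{R}^{n_1\times n_2}}\ \|X\|_*\quad\text{subject to}\quad\Phi X=M_0.$$ Let $r=\operatorname{rank}(X_0)$ and $\Delta(X_0)=\partial\|X_0\|_*\cap\operatorname{Im}\Phi^*$. The following are equivalent: (i) $X_0$ is a unique solution of the problem. (ii) For any dual certificate $Y\in\Delta(X_0)$, the system $$\Phi\left(U\begin{pmatrix}A&BC&0\\C^TB^T&C&0\\0&0&0\end{pmatrix}V^T\right)=0\quad\text{with}\quad A\in\mathbb{S}^r,\ B\in\mathbb{R}^{r\times(p-r)},\ C\in\mathbb{S}_+^{p-r}$$ gives $A=0$ and $C=0$, where the pair $(U,V)\in\mathcal{O}(X_0)\cap\mathcal{O}(Y)$ comes from a simultaneous ordered singular value decomposition of $X_0$ and $Y$, and $p=p(Y)=\#\{i\mid\sigma_i(Y)=1\}$. (iii) There exists a dual certificate $\bar Y\in\Delta(X_0)$ at which the implication in (ii) holds (with $Y=\bar Y$).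
   Context: $\mathbb{R}^{n_1\times n_2}$ carries the Frobenius inner product; $\|X\|_*$ is the nuclear norm (sum of singular values); $\partial$ is the convex subdifferential; $\Phi^*$ is the adjoint of $\Phi$. $\mathbb{S}^k$ (resp. $\mathbb{S}^k_+$) is the set of $k\times k$ symmetric (resp. symmetric positive semidefinite) matrices. $\sigma_1(X)\ge\dots\ge\sigma_{n_1}(X)\ge0$ are the singular values of $X$ in decreasing order. $\mathcal{O}(X)$ is the set of all pairs $(U,V)$ of orthogonal matrices $U\in\mathbb{R}^{n_1\times n_1}$, $V\in\mathbb{R}^{n_2\times n_2}$ with $X=U(\operatorname{Diag}\sigma(X))V^T$, where $\operatorname{Diag}\sigma(X)$ is the $n_1\times n_2$ matrix with $\sigma_1(X),\dots,\sigma_{n_1}(X)$ on the main diagonal in decreasing order and zeros elsewhere. For every $Y\in\partial\|X_0\|_*$ the set $\mathcal{O}(X_0)\cap\mathcal{O}(Y)$ is nonempty; a pair in it gives a simultaneous ordered SVD of $X_0$ and $Y$. *)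

theory Defs
  imports "Jordan_Normal_Form.Char_Poly" "HOL-Analysis.Analysis"
begin

text \<open>
  The space of \<open>n\<^sub>1 \<times> n\<^sub>2\<close> matrices is \<open>real^'n2^'n1\<close>, that is \<open>('n1, 'n2) rmat\<close>; the
  library inner product there is the Frobenius inner product. Blocks whose sizes depend on
  ranks and singular values are matrices of \<open>Jordan_Normal_Form.Matrix\<close>. A finite linearly
  ordered index type is identified with \<open>{0..<CARD('n)}\<close> by the order isomorphism \<open>pos\<close>.
\<close>

no_notation vec_index (infixl "$" 100)
no_notation scalar_prod (infix "\<bullet>" 70)

type_synonym ('m, 'n) rmat = "((real, 'n) Finite_Cartesian_Product.vec, 'm) Finite_Cartesian_Product.vec"

definition pos :: "'n::{finite,linorder} \<Rightarrow> nat" where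
  "pos i = card {..<i}"

definition to_jnf_mat :: "'a^('n::{finite,linorder})^('m::{finite,linorder}) \<Rightarrow> 'a Matrix.mat" where
  "to_jnf_mat X = Matrix.mat CARD('m) CARD('n) (\<lambda>(i, j). X $ inv_into UNIV pos i $ inv_into UNIV pos j)"

definition of_jnf_mat :: "'a Matrix.mat \<Rightarrow> 'a^('n::{finite,linorder})^('m::{finite,linorder})" where
  "of_jnf_mat M = (\<chi> i j. M $$ (pos i, pos j))"

text \<open>
  The singular values in decreasing order, repeated according to multiplicity: the square roots
  of the eigenvalues of \<open>X X\<^sup>T\<close>. There are \<open>n\<^sub>1\<close> of them, which is the right number
  for \<open>n\<^sub>1 \<le> n\<^sub>2\<close>; the list is indexed from 0.
\<close>

definition singular_values ::
  "('n1::{finite,linorder}, 'n2::{finite,linorder}) rmat \<Rightarrow> real list" where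
  "singular_values X =
     rev (sorted_list_of_multiset
       (image_mset sqrt (proots (char_poly (to_jnf_mat (X ** transpose X))))))"

definition nuclear_norm ::
  "('n1::{finite,linorder}, 'n2::{finite,linorder}) rmat \<Rightarrow> real" where
  "nuclear_norm X = sum_list (singular_values X)"

definition Diag_singular_values ::
  "('n1::{finite,linorder}, 'n2::{finite,linorder}) rmat \<Rightarrow> ('n1, 'n2) rmat" where
  "Diag_singular_values X =
     (\<chi> i j. if pos i = pos j then singular_values X ! pos i else 0)"

definition ordered_SVDs ::
  "('n1::{finite,linorder}, 'n2::{finite,linorder}) rmat \<Rightarrow> (('n1, 'n1) rmat \<times> ('n2, 'n2) rmat) set" where
  "ordered_SVDs X =
     {(U, V). orthogonal_matrix U \<and> orthogonal_matrix V \<and>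
              X = U ** Diag_singular_values X ** transpose V}"

definition subdifferential :: "('a::real_inner \<Rightarrow> real) \<Rightarrow> 'a \<Rightarrow> 'a set" where
  "subdifferential f x = {y. \<forall>z. f z \<ge> f x + y \<bullet> (z - x)}"

definition certificate_set ::
  "(('n1::{finite,linorder}, 'n2::{finite,linorder}) rmat \<Rightarrow> real^'m) \<Rightarrow> ('n1, 'n2) rmat \<Rightarrow>
   ('n1, 'n2) rmat set" where
  "certificate_set \<Phi> X0 = subdifferential nuclear_norm X0 \<inter> range (adjoint \<Phi>)"

definition sym_mats :: "nat \<Rightarrow> real Matrix.mat set" where
  "sym_mats k = {A \<in> carrier_mat k k. transpose_mat A = A}"

definition psd_mats :: "nat \<Rightarrow> real Matrix.mat set" where
  "psd_mats k = {A \<in> sym_mats k. \<forall>x \<in> carrier_vec k. 0 \<le> scalar_prod x (A *\<^sub>v x)}"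

definition num_unit_singular_values ::
  "('n1::{finite,linorder}, 'n2::{finite,linorder}) rmat \<Rightarrow> nat" where
  "num_unit_singular_values Y = card {i. i < CARD('n1) \<and> singular_values Y ! i = 1}"

definition certificate_block ::
  "nat \<Rightarrow> nat \<Rightarrow> nat \<Rightarrow> real Matrix.mat \<Rightarrow> real Matrix.mat \<Rightarrow> real Matrix.mat \<Rightarrow> real Matrix.mat" where
  "certificate_block n1 n2 p A B C =
     four_block_mat
       (four_block_mat A (B * C) (transpose_mat C * transpose_mat B) C) (0\<^sub>m p (n2 - p))
       (0\<^sub>m (n1 - p) p) (0\<^sub>m (n1 - p) (n2 - p))"

text \<open>
  The implication is required for every simultaneous ordered SVD \<open>(U, V)\<close> of \<open>X\<^sub>0\<close> and \<open>Y\<close>.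
  For \<open>Y\<close> in the subdifferential at \<open>X\<^sub>0\<close> such a pair exists and \<open>r \<le> p\<close>, so
  this is not vacuous and the truncated subtraction \<open>p - r\<close> is the true one.
\<close>

definition certificate_implication ::
  "(('n1::{finite,linorder}, 'n2::{finite,linorder}) rmat \<Rightarrow> real^'m) \<Rightarrow> ('n1, 'n2) rmat \<Rightarrow>
   ('n1, 'n2) rmat \<Rightarrow> bool" where
  "certificate_implication \<Phi> X0 Y \<longleftrightarrow>
     (let r = rank X0; p = num_unit_singular_values Y in
      \<forall>(U, V) \<in> ordered_SVDs X0 \<inter> ordered_SVDs Y.
      \<forall>A \<in> sym_mats r. \<forall>B \<in> carrier_mat r (p - r). \<forall>C \<in> psd_mats (p - r).
        \<Phi> (U ** of_jnf_mat (certificate_block CARD('n1) CARD('n2) p A B C) ** transpose V) = 0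
        \<longrightarrow> A = 0\<^sub>m r r \<and> C = 0\<^sub>m (p - r) (p - r))"

end

theory Submission
  imports Defs
begin

text \<open>
  Singular value decompositions are used in the thin form \<open>X = U diag(d) W\<close>, where \<open>U\<close> is
  orthogonal and \<open>W\<close> has orthonormal rows; for \<open>(U, V) \<in> ordered_SVDs X\<close> one has
  \<open>W = J V\<^sup>T\<close> with the rectangular identity \<open>J\<close>. In this form the nuclear norm is dual to the
  contractions: \<open>X \<bullet> Y \<le> nuclear_norm X\<close> for every contraction \<open>Y\<close>, and equality holds for
  \<open>Y = U W\<close>. Equality for some \<open>Y\<close> forces \<open>Y\<close> to map each right singular vector of \<open>X\<close> with a
  positive singular value to the left one (\<open>contraction_attaining_pairs\<close>). A subgradient \<open>Y\<close> of the
  nuclear norm at \<open>X0\<close> is a contraction that attains \<open>nuclear_norm X0\<close> at \<open>X0\<close>; from this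
  come a simultaneous ordered SVD of \<open>X0\<close> and \<open>Y\<close> (\<open>ex_simultaneous_ordered_SVD\<close>) and the
  inequality \<open>rank X0 \<le> p\<close>, where \<open>p\<close> counts the singular values of \<open>Y\<close> that equal 1.

  Fix a certificate \<open>Y\<close> and such a decomposition \<open>Y = U diag(t) W\<close>. As \<open>Y\<close> lies in the range of
  the adjoint of \<open>\<Phi>\<close>, the number \<open>X \<bullet> Y\<close> is the same for all feasible \<open>X\<close>. A feasible \<open>X\<close> is
  therefore optimal exactly if \<open>X \<bullet> Y = nuclear_norm X\<close>, and this means \<open>X = U P W\<close> with a positive
  semidefinite \<open>P\<close> that lives on the first \<open>p\<close> coordinates (\<open>nuclear_norm_face\<close> and
  \<open>nuclear_norm_psd_le\<close>). The solution \<open>X0\<close> corresponds to \<open>D = diag(d)\<close>, where \<open>d\<close> is positive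
  exactly on the first \<open>r = rank X0\<close> coordinates. So \<open>X0\<close> is the only solution iff no \<open>M \<noteq> 0\<close>
  on these \<open>p\<close> coordinates with \<open>\<Phi> (U M W) = 0\<close> makes \<open>D + M\<close> positive semidefinite.

  Up to a positive factor, the symmetric \<open>M\<close> on the first \<open>p\<close>
  coordinates with \<open>D + M\<close> positive semidefinite are the block matrices with a
  symmetric diagonal block \<open>A\<close>, a positive semidefinite diagonal block
  \<open>C\<close> and the off-diagonal block \<open>B C\<close>. If \<open>D + M\<close> is
  positive semidefinite, the kernel of its lower diagonal block \<open>C\<close> is contained in
  the kernel of the off-diagonal block, which is therefore a left multiple of \<open>C\<close>
  (\<open>psd_block_factor\<close>). Conversely, completing the square turns the form of such a
  block matrix into a nonnegative term plus the form of \<open>A - B C B\<^sup>T\<close> on the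
  first \<open>r\<close> coordinates, and there \<open>D\<close> is positive definite, so \<open>D
  + t M\<close> is positive semidefinite for a small \<open>t > 0\<close>
  (\<open>psd_feasible_direction\<close>). Finally \<open>M = 0\<close> iff \<open>A = 0\<close>
  and \<open>C = 0\<close>.

  Uniqueness is thus equivalent to the implication at each single certificate. The quantifiers
  ``for all'' and ``there is'' agree because a certificate exists: the strict epigraph of the nuclear
  norm can be separated from the feasible set at the optimal height (\<open>ex_dual_certificate\<close>).
\<close>

section \<open>Orthonormal sequences and singular pairs on invariant subspaces\<close>

definition orthonormal_seq :: "nat \<Rightarrow> (nat \<Rightarrow> 'a::real_inner) \<Rightarrow> bool" where
  "orthonormal_seq n u \<longleftrightarrow> (\<forall>i<n. \<forall>j<n. u i \<bullet> u j = (if i = j then 1 else 0))"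

lemma orthonormal_seq_cons:
  assumes "norm (a::'a::real_inner) = 1" "orthonormal_seq n u" "\<And>i. i < n \<Longrightarrow> a \<bullet> u i = 0"
  shows "orthonormal_seq (Suc n) (case_nat a u)"
  using assms by (auto simp: orthonormal_seq_def less_Suc_eq_0_disj norm_eq_1 inner_commute split: nat.splits)

lemma orthonormal_seq_append:
  assumes "orthonormal_seq n u" "r \<le> n" "orthonormal_seq k u'" "\<And>i j. i < r \<Longrightarrow> j < k \<Longrightarrow> u i \<bullet> u' j = 0"
  shows "orthonormal_seq (r + k) (\<lambda>i. if i < r then u i else u' (i - r))"
  unfolding orthonormal_seq_def
proof (intro allI impI)
  fix i j assume ij: "i < r + k" "j < r + k"
  have u: "u a \<bullet> u b = (if a = b then 1 else 0)" if "a < r" "b < r" for a b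
    using assms(1,2) that by (simp add: orthonormal_seq_def)
  have u': "u' a \<bullet> u' b = (if a = b then 1 else 0)" if "a < k" "b < k" for a b
    using assms(3) that by (simp add: orthonormal_seq_def)
  show "(if i < r then u i else u' (i - r)) \<bullet> (if j < r then u j else u' (j - r)) = (if i = j then 1 else 0)"
    using ij u[of i j] u'[of "i - r" "j - r"] assms(4)[of i "j - r"] assms(4)[of j "i - r"]
    by (auto simp: inner_commute)
qed

lemma ex_orthonormal_seq_subspace:
  fixes S :: "'a::euclidean_space set"
  assumes "subspace S"
  shows "\<exists>v. orthonormal_seq (dim S) v \<and> (\<forall>i<dim S. v i \<in> S)"
proof -
  obtain B where B: "B \<subseteq> S" "pairwise orthogonal B" "\<And>x. x \<in> B \<Longrightarrow> norm x = 1" "card B = dim S" "independent B"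
    by (rule orthonormal_basis_subspace[OF assms]) blast
  have "finite B" using B(5) by (simp add: independent_imp_finite)
  then obtain h where h: "bij_betw h {0..<card B} B"
    using ex_bij_betw_nat_finite by blast
  have "h i \<bullet> h j = (if i = j then 1 else 0)" if "i < dim S" "j < dim S" for i j
  proof -
    have "h i \<in> B" "h j \<in> B" using h that B(4) by (auto simp: bij_betw_def)
    moreover have "i \<noteq> j \<Longrightarrow> h i \<noteq> h j" using h that B(4) by (auto simp: bij_betw_def inj_on_def)
    ultimately show ?thesis using B(2,3) by (auto simp: pairwise_def orthogonal_def norm_eq_1)
  qed
  moreover have "h i \<in> S" if "i < dim S" for i using h that B by (auto simp: bij_betw_def)
  ultimately show ?thesis unfolding orthonormal_seq_def by blast
qed

lemma dim_orthogonal_hyperplane: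
  fixes S :: "'a::euclidean_space set"
  assumes S: "subspace S" and a: "a \<in> S" "norm a = 1"
  shows "dim {x \<in> S. a \<bullet> x = 0} = dim S - 1" "1 \<le> dim S"
proof -
  have sp: "span {a} \<subseteq> S" using S a by (simp add: span_minimal)
  have eq: "{y \<in> S. \<forall>x \<in> span {a}. orthogonal x y} = {x \<in> S. a \<bullet> x = 0}"
    by (auto simp: orthogonal_def span_singleton)
  have "dim {y \<in> S. \<forall>x \<in> span {a}. orthogonal x y} + dim (span {a}) = dim S"
    using dim_subspace_orthogonal_to_vectors[OF subspace_span S sp] .
  moreover have "dim (span {a}) = 1" using a by (auto simp: dim_span)
  ultimately show "dim {x \<in> S. a \<bullet> x = 0} = dim S - 1" "1 \<le> dim S" unfolding eq by auto
qed

lemma dim_orthonormal_complement: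
  fixes u :: "nat \<Rightarrow> 'a::euclidean_space"
  assumes "orthonormal_seq n u" "r \<le> n"
  shows "dim {y. \<forall>i<r. u i \<bullet> y = 0} + r = DIM('a)"
  using assms(2)
proof (induction r)
  case 0 then show ?case by (simp add: dim_UNIV)
next
  case (Suc r)
  let ?S = "{y. \<forall>i<r. u i \<bullet> y = 0}"
  have S: "subspace ?S" by (auto simp: subspace_def inner_right_distrib)
  have "u r \<in> ?S" "norm (u r) = 1" using assms Suc.prems by (auto simp: orthonormal_seq_def norm_eq_1)
  from dim_orthogonal_hyperplane[OF S this]
  have "dim {x \<in> ?S. u r \<bullet> x = 0} = dim ?S - 1" "1 \<le> dim ?S" by auto
  moreover have "{x \<in> ?S. u r \<bullet> x = 0} = {y. \<forall>i<Suc r. u i \<bullet> y = 0}" by (auto simp: less_Suc_eq)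
  ultimately show ?case using Suc by simp
qed

text \<open>
  Maximising \<open>y \<bullet> f x\<close> over pairs of unit vectors produces a singular pair: the maximum bounds
  the norms of \<open>f v\<close> and \<open>adjoint f u\<close>, and it is also their component along \<open>u\<close> and \<open>v\<close>.
\<close>

lemma ex_top_singular_pair:
  fixes f :: "'a::euclidean_space \<Rightarrow> 'b::euclidean_space"
  assumes f: "linear f" and S: "subspace S" and T: "subspace T"
    and fS: "\<And>x. x \<in> S \<Longrightarrow> f x \<in> T" and gT: "\<And>y. y \<in> T \<Longrightarrow> adjoint f y \<in> S"
    and dS: "dim S > 0" and dT: "dim T > 0"
  obtains u v t where "u \<in> T" "norm u = 1" "v \<in> S" "norm v = 1" "0 \<le> t" "f v = t *\<^sub>R u"
    "adjoint f u = t *\<^sub>R v"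
    "\<And>x y. x \<in> S \<Longrightarrow> y \<in> T \<Longrightarrow> norm x = 1 \<Longrightarrow> norm y = 1 \<Longrightarrow> y \<bullet> f x \<le> t"
proof -
  let ?K = "(S \<inter> sphere 0 1) \<times> (T \<inter> sphere 0 1)"
  have K: "compact ?K"
    using S T by (intro compact_Times closed_Int_compact closed_subspace) auto
  have ne: "\<exists>x. x \<in> A \<inter> sphere 0 1" if "subspace A" "dim A > 0" for A :: "'c::euclidean_space set"
  proof -
    obtain v where "orthonormal_seq (dim A) v" "\<forall>i<dim A. v i \<in> A"
      using ex_orthonormal_seq_subspace[OF \<open>subspace A\<close>] by blast
    with \<open>dim A > 0\<close> have "v 0 \<in> A \<inter> sphere 0 1"
      by (auto simp: orthonormal_seq_def norm_eq_1)
    then show ?thesis ..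
  qed
  have "?K \<noteq> {}" using ne[OF S dS] ne[OF T dT] by auto
  moreover have "continuous_on ?K (\<lambda>z. snd z \<bullet> f (fst z))"
    by (intro continuous_intros linear_continuous_on_compose[OF _ f])
  ultimately obtain z where z: "z \<in> ?K" "\<And>w. w \<in> ?K \<Longrightarrow> snd w \<bullet> f (fst w) \<le> snd z \<bullet> f (fst z)"
    using continuous_attains_sup[OF K] by blast
  obtain v u where vu: "z = (v, u)" by fastforce
  define t where "t = u \<bullet> f v"
  have uv: "u \<in> T" "norm u = 1" "v \<in> S" "norm v = 1" using z(1) vu by auto
  have mx: "y \<bullet> f x \<le> t" if "x \<in> S" "y \<in> T" "norm x = 1" "norm y = 1" for x y
    using z(2)[of "(x, y)"] that by (auto simp: vu t_def)
  have t0: "0 \<le> t"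
    using mx[of v "- u"] uv T by (auto simp: t_def subspace_neg)
  \<comment> \<open>A vector of norm at most \<open>t\<close> whose component along a unit vector is \<open>t\<close> is \<open>t\<close> times it.\<close>
  have eqI: "b = t *\<^sub>R a" if "norm a = 1" "a \<bullet> b = t" "norm b \<le> t" for a b :: "'c::real_inner"
  proof -
    have "(norm (b - t *\<^sub>R a))\<^sup>2 = (norm b)\<^sup>2 - t\<^sup>2"
      using that(1,2) unfolding power2_norm_eq_inner
      by (simp add: inner_diff inner_commute norm_eq_1 power2_eq_square)
    also have "\<dots> \<le> 0" using that(3) by (simp add: power_mono)
    finally show ?thesis by simp
  qed
  \<comment> \<open>Pairing \<open>f v\<close> with its own direction shows that its norm does not exceed the maximum.\<close>
  have fv: "norm (f v) \<le> t"
  proof (cases "f v = 0")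
    case False
    have "(f v /\<^sub>R norm (f v)) \<bullet> f v \<le> t"
      using False uv fS T by (intro mx) (auto simp: subspace_mul)
    then show ?thesis using False by (simp add: dot_square_norm power2_eq_square field_simps)
  qed (use t0 in simp)
  have gu: "norm (adjoint f u) \<le> t"
  proof (cases "adjoint f u = 0")
    case False
    let ?x = "adjoint f u /\<^sub>R norm (adjoint f u)"
    have "u \<bullet> f ?x \<le> t"
      using False uv gT S by (intro mx) (auto simp: subspace_mul)
    also have "u \<bullet> f ?x = ?x \<bullet> adjoint f u" by (metis adjoint_works[OF f] inner_commute)
    finally show ?thesis using False by (simp add: dot_square_norm power2_eq_square field_simps)
  qed (use t0 in simp)
  show ?thesis
  proof (rule that[OF uv t0])
    show "f v = t *\<^sub>R u" by (rule eqI) (use uv fv in \<open>auto simp: t_def\<close>)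
    show "adjoint f u = t *\<^sub>R v"
      by (rule eqI) (use uv gu in \<open>auto simp: t_def adjoint_works[OF f] inner_commute\<close>)
  qed (rule mx)
qed

text \<open>
  A singular value decomposition of the restriction of \<open>f\<close> to \<open>S\<close> and \<open>T\<close>, as sequences indexed
  from 0. The relative version is what makes an induction on dimensions possible.
\<close>

definition svd_system ::
  "('a::euclidean_space \<Rightarrow> 'b::euclidean_space) \<Rightarrow> 'a set \<Rightarrow> 'b set \<Rightarrow>
   (nat \<Rightarrow> 'b) \<Rightarrow> (nat \<Rightarrow> 'a) \<Rightarrow> (nat \<Rightarrow> real) \<Rightarrow> bool" where
  "svd_system f S T u v t \<longleftrightarrow>
     orthonormal_seq (dim T) u \<and> orthonormal_seq (dim S) v \<and>
     (\<forall>i<dim T. u i \<in> T) \<and> (\<forall>i<dim S. v i \<in> S) \<and>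
     (\<forall>i<dim T. f (v i) = t i *\<^sub>R u i \<and> 0 \<le> t i) \<and>
     (\<forall>i<dim T. \<forall>j\<le>i. t i \<le> t j) \<and> (\<forall>i<dim S. dim T \<le> i \<longrightarrow> f (v i) = 0)"

text \<open>
  Split off a top singular pair and continue in its orthogonal complements, which \<open>f\<close> and its
  adjoint again map into each other.
\<close>

lemma ex_svd_system:
  fixes f :: "'a::euclidean_space \<Rightarrow> 'b::euclidean_space"
  assumes f: "linear f" and S: "subspace S" and T: "subspace T"
    and fS: "\<And>x. x \<in> S \<Longrightarrow> f x \<in> T" and gT: "\<And>y. y \<in> T \<Longrightarrow> adjoint f y \<in> S"
    and d: "dim T \<le> dim S"
  shows "\<exists>u v t. svd_system f S T u v t"
  using S T fS gT d
proof (induction "dim T" arbitrary: S T)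
  case 0
  obtain v where v: "orthonormal_seq (dim S) v" "\<forall>i<dim S. v i \<in> S"
    using ex_orthonormal_seq_subspace[OF 0(2)] by blast
  have "T \<subseteq> {0}" using 0(1) by (simp add: dim_eq_0)
  then have "f (v i) = 0" if "i < dim S" for i using v(2) that 0(4) by blast
  then have "svd_system f S T (\<lambda>_. 0) v (\<lambda>_. 0)"
    using v unfolding svd_system_def 0(1)[symmetric] by (simp add: orthonormal_seq_def)
  then show ?case by blast
next
  case (Suc k)
  obtain u0 v0 t0 where *: "u0 \<in> T" "norm u0 = 1" "v0 \<in> S" "norm v0 = 1" "0 \<le> t0" "f v0 = t0 *\<^sub>R u0"
    "adjoint f u0 = t0 *\<^sub>R v0"
    "\<And>x y. x \<in> S \<Longrightarrow> y \<in> T \<Longrightarrow> norm x = 1 \<Longrightarrow> norm y = 1 \<Longrightarrow> y \<bullet> f x \<le> t0"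
    using ex_top_singular_pair[OF f Suc.prems(1-4)] Suc.prems(5) Suc.hyps(2) by (metis zero_less_Suc less_le_trans)
  define S' where "S' = {x \<in> S. v0 \<bullet> x = 0}"
  define T' where "T' = {x \<in> T. u0 \<bullet> x = 0}"
  have dT: "dim T = Suc (dim T')" and dS: "dim S = Suc (dim S')"
    using dim_orthogonal_hyperplane[OF Suc.prems(2) *(1,2)] dim_orthogonal_hyperplane[OF Suc.prems(1) *(3,4)]
    by (auto simp: S'_def T'_def)
  have sub: "subspace S'" "subspace T'"
    using Suc.prems(1,2) by (auto simp: S'_def T'_def subspace_def inner_right_distrib)
  have "f x \<in> T'" if "x \<in> S'" for x
  proof -
    have "u0 \<bullet> f x = adjoint f u0 \<bullet> x" by (metis adjoint_works[OF f] inner_commute)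
    then show ?thesis using that Suc.prems(3) *(7) by (simp add: S'_def T'_def)
  qed
  moreover have "adjoint f y \<in> S'" if "y \<in> T'" for y
    using that Suc.prems(4) *(6) by (auto simp: S'_def T'_def adjoint_works[OF f] inner_commute)
  ultimately obtain u v t where s: "svd_system f S' T' u v t"
    using Suc.hyps(1)[OF _ sub] Suc.hyps(2) Suc.prems(5) dT dS by auto
  have ST: "S' \<subseteq> S" "T' \<subseteq> T" by (auto simp: S'_def T'_def)
  \<comment> \<open>The maximum over \<open>S\<close> and \<open>T\<close> bounds the values found on the smaller subspaces,
    so prepending \<open>t0\<close> keeps the list decreasing.\<close>
  have tle: "t i \<le> t0" if "i < dim T'" for i
  proof -
    have "u i \<bullet> f (v i) \<le> t0"
      using s ST that Suc.prems(5) by (intro *(8)) (auto simp: svd_system_def orthonormal_seq_def norm_eq_1 dT dS)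
    then show ?thesis using s that by (auto simp: svd_system_def orthonormal_seq_def)
  qed
  have on: "orthonormal_seq (dim T) (case_nat u0 u)" "orthonormal_seq (dim S) (case_nat v0 v)"
    unfolding dT dS using s *(2,4)
    by (auto intro!: orthonormal_seq_cons simp: svd_system_def S'_def T'_def)
  have "svd_system f S T (case_nat u0 u) (case_nat v0 v) (case_nat t0 t)"
    unfolding svd_system_def using on s ST tle * by (auto simp: svd_system_def dT dS less_Suc_eq_0_disj split: nat.splits)
  then show ?case by blast
qed

section \<open>Positions in a finite linear order\<close>

lemma pos_less_card [simp]: "pos (i::'n::{finite,linorder}) < CARD('n)"
  unfolding pos_def by (rule psubset_card_mono) auto

lemma pos_strict_mono: "i < j \<Longrightarrow> pos (i::'n::{finite,linorder}) < pos j"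
  unfolding pos_def by (rule psubset_card_mono) auto

lemma pos_eq_iff [simp]: "pos (i::'n::{finite,linorder}) = pos j \<longleftrightarrow> i = j"
  by (metis pos_strict_mono less_irrefl linorder_neqE)

lemma pos_le_iff [simp]: "pos (i::'n::{finite,linorder}) \<le> pos j \<longleftrightarrow> i \<le> j"
  by (metis pos_strict_mono less_le not_less pos_eq_iff)

lemma bij_betw_pos: "bij_betw pos (UNIV::'n::{finite,linorder} set) {..<CARD('n)}"
proof -
  have inj: "inj (pos :: 'n \<Rightarrow> nat)" by (simp add: inj_def)
  moreover have "range (pos :: 'n \<Rightarrow> nat) = {..<CARD('n)}"
    by (rule card_subset_eq) (auto simp: pos_less_card card_image[OF inj])
  ultimately show ?thesis by (simp add: bij_betw_def)
qed

abbreviation unpos :: "nat \<Rightarrow> 'n::{finite,linorder}" where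
  "unpos \<equiv> inv_into UNIV pos"

lemma unpos_pos [simp]: "unpos (pos i) = (i::'n::{finite,linorder})"
  by (simp add: inj_def)

lemma pos_unpos [simp]: "k < CARD('n) \<Longrightarrow> pos (unpos k :: 'n::{finite,linorder}) = k"
  using bij_betw_pos[where 'n='n] by (simp add: bij_betw_def f_inv_into_f)

lemma bij_betw_unpos: "bij_betw unpos {..<CARD('n)} (UNIV::'n::{finite,linorder} set)"
  by (rule bij_betw_inv_into[OF bij_betw_pos])

lemma sum_unpos: "(\<Sum>k<CARD('n). f (unpos k)) = (\<Sum>i\<in>UNIV. f (i::'n::{finite,linorder}))"
  by (rule sum.reindex_bij_betw[OF bij_betw_unpos])

lemma sum_pos_eq:
  "(\<Sum>j\<in>UNIV. if k = pos j then f j else 0) = (if k < CARD('n) then f (unpos k :: 'n::{finite,linorder}) else (0::real))"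
proof (cases "k < CARD('n)")
  case True
  then have "(k = pos j) = (j = unpos k)" for j :: 'n by auto
  then show ?thesis using True by simp
next
  case False
  then have "k \<noteq> pos j" for j :: 'n using pos_less_card[of j] by auto
  then show ?thesis using False by simp
qed

lemma sum_pos_window:
  assumes "r + k \<le> CARD('n)"
  shows "(\<Sum>i\<in>(UNIV::'n::{finite,linorder} set). if r \<le> pos i \<and> pos i < r + k then f (pos i - r) else 0) = (\<Sum>x<k. f x :: real)"
proof -
  have "(\<Sum>i\<in>(UNIV::'n set). if r \<le> pos i \<and> pos i < r + k then f (pos i - r) else 0)
    = (\<Sum>m<CARD('n). if r \<le> m \<and> m < r + k then f (m - r) else 0)"
    by (rule sum.reindex_bij_betw[OF bij_betw_pos])
  also have "\<dots> = (\<Sum>m\<in>{r..<r + k}. f (m - r))"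
    using assms by (intro sum.mono_neutral_cong_right) auto
  also have "\<dots> = (\<Sum>x<k. f x)"
    by (rule sum.reindex_bij_witness[of _ "\<lambda>x. x + r" "\<lambda>m. m - r"]) auto
  finally show ?thesis .
qed

lemma down_closed_card:
  assumes "\<And>i j. i < n \<Longrightarrow> j \<le> i \<Longrightarrow> P i \<Longrightarrow> P j"
  shows "i < n \<Longrightarrow> P i \<longleftrightarrow> i < card {i. i < n \<and> P i}" "card {i. i < n \<and> P i} \<le> n"
proof -
  let ?A = "{i. i < n \<and> P i}"
  have fin: "finite ?A" by simp
  have "card ?A \<le> card {..<n}" by (rule card_mono) auto
  then show "card ?A \<le> n" by simp
  assume i: "i < n"
  show "P i \<longleftrightarrow> i < card ?A"
  proof
    assume "P i"
    then have "{..i} \<subseteq> ?A" using i assms by auto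
    from card_mono[OF fin this] show "i < card ?A" by simp
  next
    assume *: "i < card ?A"
    show "P i"
    proof (rule ccontr)
      assume "\<not> P i"
      then have "?A \<subseteq> {..<i}" using assms by (auto simp: not_less[symmetric])
      from card_mono[OF _ this] show False using * by simp
    qed
  qed
qed

text \<open>
  Since singular values decrease, the indices with a positive value, and those with the value 1 of a
  contraction, form an initial segment.
\<close>

lemma down_closed_pos:
  fixes P :: "'n::{finite,linorder} \<Rightarrow> bool"
  assumes "\<And>i j. j \<le> i \<Longrightarrow> P i \<Longrightarrow> P j"
  shows "P i \<longleftrightarrow> pos i < card {i. P i}"
proof -
  have "bij_betw pos {i. P i} {k. k < CARD('n) \<and> P (unpos k)}"
    by (rule bij_betw_byWitness[of _ unpos]) auto
  then have eq: "card {i. P i} = card {k. k < CARD('n) \<and> P (unpos k)}" by (rule bij_betw_same_card)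
  have "P (unpos j)" if "k < CARD('n)" "j \<le> k" "P (unpos k)" for j k
  proof (rule assms[OF _ that(3)])
    have "pos (unpos j :: 'n) \<le> pos (unpos k :: 'n)" using that by simp
    then show "(unpos j :: 'n) \<le> unpos k" by (simp only: pos_le_iff)
  qed
  then show ?thesis
    using down_closed_card(1)[of "CARD('n)" "\<lambda>k. P (unpos k)" "pos i"] unfolding eq by force
qed

section \<open>Matrix algebra\<close>

abbreviation id_mat :: "real^'n^'n" where
  "id_mat \<equiv> Finite_Cartesian_Product.mat 1"

lemma orthogonal_matrix_inverse:
  assumes "orthogonal_matrix (U::real^'n^'n)"
  shows "transpose U ** U = id_mat" "U ** transpose U = id_mat"
  using assms by (auto simp: orthogonal_matrix_def)

lemma inner_matrix_mult_left:
  fixes A :: "real^'n^'m" and B :: "real^'k^'n"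
  shows "(A ** B) \<bullet> C = B \<bullet> (transpose A ** C)"
proof -
  have "(A ** B) \<bullet> C = (\<Sum>i\<in>UNIV. \<Sum>j\<in>UNIV. \<Sum>k\<in>UNIV. A$i$k * B$k$j * C$i$j)"
    by (simp add: inner_vec_def matrix_matrix_mult_def sum_distrib_right)
  also have "\<dots> = (\<Sum>i\<in>UNIV. \<Sum>k\<in>UNIV. \<Sum>j\<in>UNIV. A$i$k * B$k$j * C$i$j)"
    by (intro sum.cong refl sum.swap)
  also have "\<dots> = (\<Sum>k\<in>UNIV. \<Sum>i\<in>UNIV. \<Sum>j\<in>UNIV. A$i$k * B$k$j * C$i$j)"
    by (rule sum.swap)
  also have "\<dots> = (\<Sum>k\<in>UNIV. \<Sum>j\<in>UNIV. \<Sum>i\<in>UNIV. A$i$k * B$k$j * C$i$j)"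
    by (intro sum.cong refl sum.swap)
  also have "\<dots> = B \<bullet> (transpose A ** C)"
    by (simp add: inner_vec_def matrix_matrix_mult_def sum_distrib_left transpose_def mult_ac)
  finally show ?thesis .
qed

lemma inner_transpose: "transpose A \<bullet> transpose B = (A::real^'n^'m) \<bullet> B"
  unfolding inner_vec_def transpose_def by simp (rule sum.swap)

lemma inner_matrix_mult_right:
  fixes A :: "real^'n^'m" and B :: "real^'k^'n"
  shows "(A ** B) \<bullet> C = A \<bullet> (C ** transpose B)"
proof -
  have "(A ** B) \<bullet> C = (transpose B ** transpose A) \<bullet> transpose C"
    by (metis inner_transpose matrix_transpose_mul)
  also have "\<dots> = transpose A \<bullet> (B ** transpose C)" by (simp add: inner_matrix_mult_left)
  also have "\<dots> = A \<bullet> (C ** transpose B)" by (metis inner_transpose matrix_transpose_mul transpose_transpose)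
  finally show ?thesis .
qed

lemma inner_matrix_vector: "x \<bullet> (A *v y) = (transpose A *v x) \<bullet> (y::real^'n)"
  by (metis dot_lmul_matrix vector_transpose_matrix transpose_transpose)

lemma row_inner: "row i W \<bullet> x = (W *v x) $ i"
  by (simp add: inner_vec_def matrix_vector_mult_def row_def)

lemma matrix_mult_affine:
  fixes U :: "real^'n^'m" and W :: "real^'k^'l"
  shows "U ** (D + t *\<^sub>R K) ** W = U ** D ** W + t *\<^sub>R (U ** K ** W)"
proof -
  have "U ** (D + t *\<^sub>R K) = U ** D + t *\<^sub>R (U ** K)"
    by (simp add: vec_eq_iff matrix_matrix_mult_def sum.distrib sum_distrib_left algebra_simps)
  moreover have "(U ** D + t *\<^sub>R (U ** K)) ** W = U ** D ** W + t *\<^sub>R (U ** K ** W)"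
    unfolding matrix_matrix_mult_def[of _ W]
    by (simp add: vec_eq_iff sum.distrib sum_distrib_left algebra_simps)
  ultimately show ?thesis by simp
qed

definition diagm :: "real^'n \<Rightarrow> real^'n^'n" where
  "diagm d = (\<chi> i j. if i = j then d $ i else 0)"

lemma diagm_mult: "(diagm d ** A) $ i $ j = d $ i * A $ i $ j"
  by (simp add: diagm_def matrix_matrix_mult_def if_distrib[of "\<lambda>x. x * _"] cong: if_cong)

lemma mult_diagm: "(A ** diagm d) $ i $ j = A $ i $ j * d $ j"
  by (simp add: diagm_def matrix_matrix_mult_def if_distrib cong: if_cong)

lemma diagm_vec: "(diagm d *v x) $ i = d $ i * x $ i"
  by (simp add: diagm_def matrix_vector_mult_def if_distrib[of "\<lambda>x. x * _"] cong: if_cong)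

lemma transpose_diagm [simp]: "transpose (diagm d) = diagm d"
  by (auto simp: diagm_def transpose_def vec_eq_iff)

lemma diagm_diagm: "diagm d ** diagm e = diagm (\<chi> i. d $ i * e $ i)"
  by (auto simp: vec_eq_iff diagm_mult) (auto simp: diagm_def)

lemma inner_diagm: "diagm d \<bullet> G = (\<Sum>i\<in>UNIV. d $ i * G $ i $ i)"
  by (simp add: inner_vec_def diagm_def if_distrib[of "\<lambda>x. x * _"] cong: if_cong)

lemma inner_svd:
  fixes U :: "real^'n^'m" and W :: "real^'k^'n"
  shows "(U ** diagm d ** W) \<bullet> Y = (\<Sum>i\<in>UNIV. d $ i * (column i U \<bullet> (Y *v row i W)))"
proof -
  have "(U ** diagm d ** W) \<bullet> Y = diagm d \<bullet> (transpose U ** (Y ** transpose W))"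
    by (simp only: inner_matrix_mult_right[of "U ** diagm d" W] inner_matrix_mult_left[of U])
  also have "\<dots> = (\<Sum>i\<in>UNIV. d $ i * (transpose U ** (Y ** transpose W)) $ i $ i)"
    by (rule inner_diagm)
  also have "\<dots> = (\<Sum>i\<in>UNIV. d $ i * (column i U \<bullet> (Y *v row i W)))"
    by (simp add: inner_vec_def column_def matrix_matrix_mult_def matrix_vector_mult_def transpose_def row_def)
  finally show ?thesis .
qed

lemma norm_column_isometry:
  assumes "transpose U ** U = id_mat"
  shows "norm (column i (U::real^'n^'m)) = 1"
proof -
  have "column i U \<bullet> column i U = (transpose U ** U) $ i $ i"
    by (simp add: inner_vec_def column_def transpose_def matrix_matrix_mult_def)
  then show ?thesis using assms by (simp add: norm_eq_1 Finite_Cartesian_Product.mat_def)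
qed

lemma norm_row_coisometry:
  assumes "W ** transpose W = id_mat"
  shows "norm (row i (W::real^'n^'m)) = 1"
  using norm_column_isometry[of "transpose W" i] assms by simp

lemma norm_isometry:
  assumes "transpose U ** U = id_mat"
  shows "norm (U *v x) = norm (x :: real^'n)"
  by (simp add: norm_eq_sqrt_inner inner_matrix_vector matrix_vector_mul_assoc assms)

lemma svd_vectors:
  fixes U :: "real^'n^'m" and W :: "real^'k^'n"
  assumes U: "transpose U ** U = id_mat"
    and W: "W ** transpose W = id_mat"
  shows "(U ** diagm d ** W) *v row i W = d $ i *\<^sub>R column i U"
    and "transpose (U ** diagm d ** W) *v column i U = d $ i *\<^sub>R row i W"
proof -
  have gen: "(U ** diagm d ** W) *v row i W = d $ i *\<^sub>R column i U"
    if "W ** transpose W = id_mat"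
    for U :: "real^'a^'b" and W :: "real^'c^'a" and d i
  proof -
    have "W *v row i W = axis i 1"
    proof -
      have "W *v row i W = column i (W ** transpose W)"
        by (simp add: vec_eq_iff matrix_vector_mult_def row_def column_def matrix_matrix_mult_def transpose_def)
      then show ?thesis unfolding that
        by (simp add: vec_eq_iff column_def Finite_Cartesian_Product.mat_def axis_def)
    qed
    then have "(U ** diagm d ** W) *v row i W = column i (U ** diagm d)"
      by (metis matrix_vector_mul_assoc matrix_vector_mult_basis)
    then show ?thesis by (simp add: vec_eq_iff column_def mult_diagm)
  qed
  show "(U ** diagm d ** W) *v row i W = d $ i *\<^sub>R column i U" by (rule gen[OF W])
  have "transpose (U ** diagm d ** W) *v column i U = (transpose W ** diagm d ** transpose U) *v row i (transpose U)"
    by (simp only: matrix_transpose_mul transpose_diagm matrix_mul_assoc row_transpose)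
  also have "\<dots> = d $ i *\<^sub>R column i (transpose W)" by (rule gen) (simp add: U)
  finally show "transpose (U ** diagm d ** W) *v column i U = d $ i *\<^sub>R row i W" by simp
qed

lemma rank_diagm:
  fixes d :: "real^'n"
  shows "rank (diagm d) = card {i. d $ i \<noteq> 0}"
proof -
  have "range ((*v) (diagm d)) = {x. \<forall>i. i \<notin> {i. d $ i \<noteq> 0} \<longrightarrow> x $ i = 0}"
  proof (intro equalityI subsetI)
    fix x :: "real^'n" assume "x \<in> {x. \<forall>i. i \<notin> {i. d $ i \<noteq> 0} \<longrightarrow> x $ i = 0}"
    then have "x = diagm d *v (\<chi> i. x $ i / d $ i)" by (auto simp: vec_eq_iff diagm_vec)
    then show "x \<in> range ((*v) (diagm d))" by blast
  qed (auto simp: diagm_vec)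
  then show ?thesis using dim_substandard_cart[of "{i. d $ i \<noteq> 0}"] by (simp add: rank_dim_range dim_vec_eq[symmetric])
qed

lemma rank_svd:
  fixes U :: "real^'n^'m" and W :: "real^'k^'n"
  assumes "transpose U ** U = id_mat" "W ** transpose W = id_mat"
  shows "rank (U ** D ** W) = rank D"
proof (rule antisym)
  show "rank (U ** D ** W) \<le> rank D"
    by (metis rank_mul_le_left rank_mul_le_right order_trans)
  have "transpose U ** (U ** D ** W) ** transpose W = (transpose U ** U) ** D ** (W ** transpose W)"
    by (simp add: matrix_mul_assoc)
  then have "D = transpose U ** (U ** D ** W) ** transpose W" using assms by simp
  then show "rank D \<le> rank (U ** D ** W)"
    by (metis rank_mul_le_left rank_mul_le_right order_trans)
qed

definition rect_id :: "('n1::{finite,linorder}, 'n2::{finite,linorder}) rmat" where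
  "rect_id = (\<chi> i j. if pos i = pos j then 1 else 0)"

text \<open>
  Every row of \<open>J\<close> is a unit vector since \<open>n\<^sub>1 \<le> n\<^sub>2\<close>; with more rows than columns the last rows
  would be 0.
\<close>

lemma rect_id_transpose:
  assumes "CARD('n1) \<le> CARD('n2)"
  shows "(rect_id :: ('n1::{finite,linorder}, 'n2::{finite,linorder}) rmat) ** transpose rect_id = id_mat"
proof -
  have "pos (i::'n1) < CARD('n2)" for i using pos_less_card[of i] assms by linarith
  then show ?thesis
    by (simp add: vec_eq_iff matrix_matrix_mult_def transpose_def rect_id_def Finite_Cartesian_Product.mat_def
      if_distrib[of "\<lambda>x. x * _"] sum_pos_eq cong: if_cong)
qed

lemma thin_coisometry:
  assumes "CARD('n1) \<le> CARD('n2)" and "orthogonal_matrix (V :: ('n2, 'n2) rmat)"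
  shows "((rect_id :: ('n1::{finite,linorder}, 'n2::{finite,linorder}) rmat) ** transpose V)
    ** transpose (rect_id ** transpose V) = id_mat"
proof -
  let ?J = "rect_id :: ('n1, 'n2) rmat"
  have "(?J ** transpose V) ** transpose (?J ** transpose V) = ?J ** (transpose V ** V) ** transpose ?J"
    by (simp add: matrix_transpose_mul matrix_mul_assoc)
  then show ?thesis using assms by (simp add: orthogonal_matrix_inverse rect_id_transpose)
qed

section \<open>Singular values and ordered singular value decompositions\<close>

lemma to_jnf_mat_carrier:
  "to_jnf_mat (A :: ('m::{finite,linorder}, 'n::{finite,linorder}) rmat) \<in> carrier_mat CARD('m) CARD('n)"
  by (simp add: to_jnf_mat_def)

lemma to_jnf_mat_mult:
  fixes A :: "('m::{finite,linorder}, 'n::{finite,linorder}) rmat" and B :: "('n, 'k::{finite,linorder}) rmat"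
  shows "to_jnf_mat (A ** B) = to_jnf_mat A * to_jnf_mat B"
  by (rule eq_matI)
    (auto simp: to_jnf_mat_def scalar_prod_def matrix_matrix_mult_def atLeast0LessThan sum_unpos[symmetric])

lemma to_jnf_mat_one: "to_jnf_mat (id_mat :: ('n::{finite,linorder}, 'n) rmat) = 1\<^sub>m CARD('n)"
proof -
  have "(unpos i = (unpos j :: 'n)) = (i = j)" if "i < CARD('n)" "j < CARD('n)" for i j
    using that by (metis pos_unpos)
  then show ?thesis
    by (intro eq_matI) (auto simp: to_jnf_mat_def Finite_Cartesian_Product.mat_def)
qed

lemma char_poly_orthogonal_conj:
  fixes U E :: "('n::{finite,linorder}, 'n) rmat"
  assumes "orthogonal_matrix U"
  shows "char_poly (to_jnf_mat (U ** E ** transpose U)) = char_poly (to_jnf_mat E)"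
proof (rule char_poly_similar)
  show "similar_mat (to_jnf_mat (U ** E ** transpose U)) (to_jnf_mat E)"
    unfolding similar_mat_def similar_mat_wit_def Let_def
    using to_jnf_mat_carrier[of U] to_jnf_mat_carrier[of "transpose U"] to_jnf_mat_carrier[of E]
      orthogonal_matrix_inverse[OF assms]
    by (intro exI[of _ "to_jnf_mat U"] exI[of _ "to_jnf_mat (transpose U)"])
       (auto simp: to_jnf_mat_mult[symmetric] to_jnf_mat_one to_jnf_mat_carrier
          carrier_matD(1)[OF to_jnf_mat_carrier])
qed

lemma proots_char_poly_diagm:
  "proots (char_poly (to_jnf_mat (diagm (d :: real^('n::{finite,linorder}))))) = image_mset (($) d) (mset_set UNIV)"
proof -
  let ?D = "to_jnf_mat (diagm d)"
  have ut: "upper_triangular ?D"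
    by (auto simp: upper_triangular_def to_jnf_mat_def diagm_def) (metis less_irrefl less_trans pos_unpos)
  have "diag_mat ?D = map (\<lambda>k. d $ unpos k) [0..<CARD('n)]"
    by (auto simp: diag_mat_def to_jnf_mat_def diagm_def)
  then have "char_poly ?D = (\<Prod>k\<leftarrow>[0..<CARD('n)]. [:- (d $ unpos k), 1:])"
    using char_poly_upper_triangular[OF to_jnf_mat_carrier ut] by (simp add: o_def)
  also have "\<dots> = (\<Prod>k<CARD('n). [:- (d $ unpos k), 1:])"
    using prod.distinct_set_conv_list[of "[0..<CARD('n)]" "\<lambda>k. [:- (d $ unpos k), 1:]"] by (simp add: atLeast0LessThan)
  also have "proots \<dots> = (\<Sum>k<CARD('n). {#d $ unpos k#})"
    by (subst proots_prod) auto
  also have "\<dots> = (\<Sum>i\<in>UNIV. {#d $ (i::'n)#})" by (rule sum_unpos)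
  also have "\<dots> = image_mset (($) d) (mset_set UNIV)"
    by (simp add: sum_unfold_sum_mset)
  finally show ?thesis .
qed

definition sv_vec :: "('n1::{finite,linorder}, 'n2::{finite,linorder}) rmat \<Rightarrow> real^('n1::{finite,linorder})" where
  "sv_vec X = (\<chi> i. singular_values X ! pos i)"

text \<open>
  Any decomposition with decreasing nonnegative \<open>d\<close> shows the singular values: \<open>X X\<^sup>T\<close> is
  orthogonally similar to the diagonal matrix of the squares of \<open>d\<close>, whose characteristic polynomial
  has these squares as roots.
\<close>

lemma singular_values_unique:
  fixes U :: "('n1::{finite,linorder}, 'n1) rmat" and W :: "('n1, 'n2::{finite,linorder}) rmat"
  assumes U: "orthogonal_matrix U" and W: "W ** transpose W = id_mat"
    and d: "\<And>i. 0 \<le> d $ i" "\<And>i j. i \<le> j \<Longrightarrow> d $ j \<le> d $ i"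
  shows "singular_values (U ** diagm d ** W) = map (\<lambda>k. d $ unpos k) [0..<CARD('n1)]"
proof -
  let ?X = "U ** diagm d ** W" and ?xs = "map (\<lambda>k. d $ unpos k) [0..<CARD('n1)]"
  have "?X ** transpose ?X = U ** diagm d ** (W ** transpose W) ** diagm d ** transpose U"
    by (simp add: matrix_transpose_mul matrix_mul_assoc)
  also have "\<dots> = U ** (diagm d ** diagm d) ** transpose U"
    by (simp add: W matrix_mul_assoc)
  finally have "char_poly (to_jnf_mat (?X ** transpose ?X)) = char_poly (to_jnf_mat (diagm (\<chi> i. d $ i * d $ i)))"
    by (simp add: char_poly_orthogonal_conj[OF U] diagm_diagm)
  \<comment> \<open>The square root undoes the square because \<open>d\<close> is nonnegative.\<close>
  then have "image_mset sqrt (proots (char_poly (to_jnf_mat (?X ** transpose ?X)))) = image_mset (($) d) (mset_set UNIV)"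
    using d by (simp add: proots_char_poly_diagm image_mset.compositionality o_def)
  also have "\<dots> = image_mset (($) d) (image_mset unpos (mset_set {..<CARD('n1)}))"
    using bij_betw_unpos[where 'n='n1] by (simp add: image_mset_mset_set bij_betw_def)
  also have "\<dots> = mset ?xs"
    by (simp add: image_mset.compositionality o_def mset_upt atLeast0LessThan)
  finally have "singular_values ?X = rev (sort ?xs)"
    unfolding singular_values_def by (simp only: sorted_list_of_multiset_mset)
  also have "sort ?xs = rev ?xs"
  proof (rule properties_for_sort)
    have "d $ unpos j \<le> d $ unpos i" if "i \<le> j" "j < CARD('n1)" for i j
    proof (rule d(2))
      show "unpos i \<le> (unpos j :: 'n1)"
        using that pos_strict_mono[of "unpos j :: 'n1" "unpos i"] by (metis not_less pos_unpos le_less_trans)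
    qed
    then show "sorted (rev ?xs)" by (auto simp: sorted_rev_iff_nth_mono)
  qed simp
  finally show ?thesis by simp
qed

lemma sv_vec_unique:
  fixes U :: "('n1::{finite,linorder}, 'n1) rmat" and W :: "('n1, 'n2::{finite,linorder}) rmat"
  assumes "orthogonal_matrix U" "W ** transpose W = id_mat"
    and "\<And>i. 0 \<le> d $ i" "\<And>i j. i \<le> j \<Longrightarrow> d $ j \<le> d $ i"
  shows "sv_vec (U ** diagm d ** W) = d"
  using singular_values_unique[OF assms] by (simp add: sv_vec_def vec_eq_iff)

lemma Diag_singular_values_eq: "Diag_singular_values X = diagm (sv_vec X) ** rect_id"
  by (auto simp: Diag_singular_values_def vec_eq_iff diagm_mult sv_vec_def rect_id_def)

lemma ordered_SVDs_iff:
  "(U, V) \<in> ordered_SVDs X \<longleftrightarrow> orthogonal_matrix U \<and> orthogonal_matrix V \<and>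
     X = U ** diagm (sv_vec X) ** (rect_id ** transpose V)"
  by (simp add: ordered_SVDs_def Diag_singular_values_eq matrix_mul_assoc)

definition columns_mat :: "(nat \<Rightarrow> real^('n::{finite,linorder})) \<Rightarrow> ('n::{finite,linorder}, 'n) rmat" where
  "columns_mat u = (\<chi> a i. u (pos i) $ a)"

lemma orthogonal_columns_mat:
  assumes "orthonormal_seq CARD('n) u"
  shows "orthogonal_matrix (columns_mat u :: ('n::{finite,linorder}, 'n) rmat)"
proof -
  have "u (pos i) \<bullet> u (pos j) = (if i = j then 1 else 0)" for i j :: 'n
    using assms by (simp add: orthonormal_seq_def)
  then show ?thesis
    by (simp add: orthogonal_matrix vec_eq_iff matrix_matrix_mult_def transpose_def columns_mat_def
        Finite_Cartesian_Product.mat_def inner_vec_def)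
qed

lemma ordered_SVD_of_orthonormal_seq:
  fixes X :: "('n1::{finite,linorder}, 'n2::{finite,linorder}) rmat"
  assumes le: "CARD('n1) \<le> CARD('n2)"
    and u: "orthonormal_seq CARD('n1) u" and v: "orthonormal_seq CARD('n2) v"
    and X: "\<And>i. i < CARD('n1) \<Longrightarrow> X *v v i = t i *\<^sub>R u i"
    and X0: "\<And>i. CARD('n1) \<le> i \<Longrightarrow> i < CARD('n2) \<Longrightarrow> X *v v i = 0"
    and t: "\<And>i. i < CARD('n1) \<Longrightarrow> 0 \<le> t i" "\<And>i j. j \<le> i \<Longrightarrow> i < CARD('n1) \<Longrightarrow> t i \<le> t j"
  shows "(columns_mat u, columns_mat v) \<in> ordered_SVDs X" "sv_vec X = (\<chi> i. t (pos i))"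
proof -
  let ?U = "columns_mat u" and ?V = "columns_mat v" and ?d = "\<chi> i. t (pos i)"
  let ?J = "rect_id :: ('n1, 'n2) rmat"
  have UV: "orthogonal_matrix ?U" "orthogonal_matrix ?V"
    using u v by (auto intro: orthogonal_columns_mat)
  have "X ** ?V = ?U ** diagm ?d ** ?J"
  proof (simp add: vec_eq_iff, intro allI)
    fix a j
    have l: "(X ** ?V) $ a $ j = (X *v v (pos j)) $ a"
      by (simp add: matrix_matrix_mult_def matrix_vector_mult_def columns_mat_def)
    have eq: "(\<Sum>k\<in>UNIV. (?U ** diagm ?d) $ a $ k * ?J $ k $ j) =
      (\<Sum>k\<in>UNIV. if pos j = pos k then (?U ** diagm ?d) $ a $ k else 0)"
      by (rule sum.cong) (auto simp: rect_id_def)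
    have r: "(?U ** diagm ?d ** ?J) $ a $ j = (if pos j < CARD('n1) then u (pos j) $ a * t (pos j) else 0)"
      unfolding matrix_matrix_mult_def[of "?U ** diagm ?d"] using eq
      by (simp add: sum_pos_eq mult_diagm) (simp add: columns_mat_def)
    show "(X ** ?V) $ a $ j = (?U ** diagm ?d ** ?J) $ a $ j"
      unfolding l r using X[of "pos j"] X0[of "pos j"] pos_less_card[of j] by auto
  qed
  then have "X ** (?V ** transpose ?V) = ?U ** diagm ?d ** (?J ** transpose ?V)"
    by (metis matrix_mul_assoc)
  then have eq: "X = ?U ** diagm ?d ** (?J ** transpose ?V)"
    by (simp add: orthogonal_matrix_inverse UV)
  have mono: "?d $ j \<le> ?d $ i" if "i \<le> j" for i j :: 'n1
    using that t(2)[of "pos i" "pos j"] by simp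
  have "sv_vec (?U ** diagm ?d ** (?J ** transpose ?V)) = ?d"
    by (rule sv_vec_unique[OF UV(1) thin_coisometry[OF le UV(2)]]) (use t mono pos_less_card in auto)
  with eq show sv: "sv_vec X = ?d" by simp
  show "(?U, ?V) \<in> ordered_SVDs X"
    unfolding ordered_SVDs_iff sv using eq UV by blast
qed

lemma ex_ordered_SVD_props:
  fixes X :: "('n1::{finite,linorder}, 'n2::{finite,linorder}) rmat"
  assumes le: "CARD('n1) \<le> CARD('n2)"
  shows "ordered_SVDs X \<noteq> {}" "0 \<le> sv_vec X $ i" "j \<le> i \<Longrightarrow> sv_vec X $ i \<le> sv_vec X $ j"
    "length (singular_values X) = CARD('n1)"
proof -
  obtain u v t where s: "svd_system ((*v) X) UNIV UNIV u v t"
    using ex_svd_system[of "(*v) X" UNIV UNIV] le by (auto simp: dim_UNIV)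
  note * = ordered_SVD_of_orthonormal_seq[OF le, of u v X t]
  have ineq: "\<And>i. i < CARD('n1) \<Longrightarrow> 0 \<le> t i" "\<And>i j. j \<le> i \<Longrightarrow> i < CARD('n1) \<Longrightarrow> t i \<le> t j"
    using s by (auto simp: svd_system_def)
  have mem: "(columns_mat u, columns_mat v) \<in> ordered_SVDs X" and sv: "sv_vec X = (\<chi> i. t (pos i))"
    using s by (auto intro!: * simp: svd_system_def)
  show "ordered_SVDs X \<noteq> {}" using mem by blast
  show p: "0 \<le> sv_vec X $ i" for i using ineq(1) pos_less_card by (simp add: sv)
  show q: "sv_vec X $ i \<le> sv_vec X $ j" if "j \<le> i" for i j
    using that ineq(2)[of "pos j" "pos i"] by (simp add: sv)
  have eq: "X = columns_mat u ** diagm (sv_vec X) ** (rect_id ** transpose (columns_mat v))"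
    and o: "orthogonal_matrix (columns_mat u :: ('n1, 'n1) rmat)" "orthogonal_matrix (columns_mat v :: ('n2, 'n2) rmat)"
    using mem by (auto simp: ordered_SVDs_iff)
  show "length (singular_values X) = CARD('n1)"
    by (subst eq, subst singular_values_unique[OF o(1) thin_coisometry[OF le o(2)]]) (auto intro: p q)
qed

lemma obtain_thin_SVD:
  fixes X :: "('n1::{finite,linorder}, 'n2::{finite,linorder}) rmat"
  assumes "CARD('n1) \<le> CARD('n2)"
  obtains U :: "('n1,'n1) rmat" and W :: "('n1,'n2) rmat" where "orthogonal_matrix U"
    "W ** transpose W = id_mat" "X = U ** diagm (sv_vec X) ** W"
proof -
  obtain U V where "(U, V) \<in> ordered_SVDs X" using ex_ordered_SVD_props(1)[OF assms, of X] by auto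
  then show ?thesis using that thin_coisometry[OF assms] unfolding ordered_SVDs_iff by blast
qed

lemma nuclear_norm_eq_sum:
  fixes X :: "('n1::{finite,linorder}, 'n2::{finite,linorder}) rmat"
  assumes "CARD('n1) \<le> CARD('n2)"
  shows "nuclear_norm X = (\<Sum>i\<in>UNIV. sv_vec X $ i)"
proof -
  have "nuclear_norm X = (\<Sum>k<CARD('n1). singular_values X ! k)"
    unfolding nuclear_norm_def sum_list_sum_nth ex_ordered_SVD_props(4)[OF assms] by (simp add: atLeast0LessThan)
  also have "\<dots> = (\<Sum>k<CARD('n1). sv_vec X $ unpos k)"
    by (rule sum.cong) (auto simp: sv_vec_def)
  finally show ?thesis by (simp add: sum_unpos)
qed

section \<open>Duality of the nuclear norm and the contractions\<close>

definition contraction :: "real^'n^'m \<Rightarrow> bool" where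
  "contraction Y \<longleftrightarrow> (\<forall>x. norm (Y *v x) \<le> norm x)"

lemma contraction_transpose:
  assumes "contraction Y" shows "contraction (transpose Y)"
  unfolding contraction_def
proof
  fix u
  let ?y = "transpose Y *v u"
  have "norm ?y * norm ?y = u \<bullet> (Y *v ?y)"
    by (simp add: inner_matrix_vector power2_norm_eq_inner[symmetric] power2_eq_square)
  also have "\<dots> \<le> norm u * norm (Y *v ?y)" by (rule norm_cauchy_schwarz)
  also have "\<dots> \<le> norm u * norm ?y" using assms by (intro mult_left_mono) (auto simp: contraction_def)
  finally show "norm ?y \<le> norm u" by (cases "?y = 0") auto
qed

lemma contraction_coisometry:
  assumes "W ** transpose W = id_mat"
  shows "contraction W"
proof -
  have "contraction (transpose W)" using norm_isometry[of "transpose W"] assms by (simp add: contraction_def)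
  then show ?thesis using contraction_transpose by fastforce
qed

lemma contraction_mult: "contraction A \<Longrightarrow> contraction B \<Longrightarrow> contraction (A ** B)"
  unfolding contraction_def by (metis matrix_vector_mul_assoc order_trans)

lemma contraction_inner_le:
  assumes "contraction Y" shows "a \<bullet> (Y *v b) \<le> norm a * norm b"
proof -
  have "a \<bullet> (Y *v b) \<le> norm a * norm (Y *v b)" by (rule norm_cauchy_schwarz)
  also have "\<dots> \<le> norm a * norm b" using assms by (intro mult_left_mono) (auto simp: contraction_def)
  finally show ?thesis .
qed

text \<open>
  Equality in the Cauchy-Schwarz inequality.
\<close>

lemma contraction_unit_eq:
  assumes "contraction Y" "norm a = 1" "norm b = 1" "a \<bullet> (Y *v b) = 1"
  shows "Y *v b = a"
proof -
  have "norm (Y *v b) \<le> 1" using assms(1,3) unfolding contraction_def by metis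
  then have "(Y *v b) \<bullet> (Y *v b) \<le> 1"
    by (simp add: power2_norm_eq_inner[symmetric] power_le_one)
  moreover have "(norm (Y *v b - a))\<^sup>2 = (Y *v b) \<bullet> (Y *v b) - 1"
    using assms(2,4) unfolding power2_norm_eq_inner by (simp add: inner_diff inner_commute norm_eq_1)
  ultimately have "(norm (Y *v b - a))\<^sup>2 \<le> 0" by linarith
  then show ?thesis by simp
qed

text \<open>
  The inner product is \<open>\<Sum>i. d $ i * (u\<^sub>i \<bullet> Y w\<^sub>i)\<close> with unit vectors \<open>u\<^sub>i\<close>, \<open>w\<^sub>i\<close>, and each term is at
  most \<open>d $ i\<close>. If the sums agree, so do the terms.
\<close>

lemma contraction_attaining_pairs:
  fixes U :: "real^'n^'m" and W :: "real^'k^'n"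
  assumes U: "transpose U ** U = id_mat"
    and W: "W ** transpose W = id_mat"
    and d: "\<And>i. 0 \<le> d $ i" and Y: "contraction Y"
  shows "(U ** diagm d ** W) \<bullet> Y \<le> (\<Sum>i\<in>UNIV. d $ i)"
    and "(U ** diagm d ** W) \<bullet> Y = (\<Sum>i\<in>UNIV. d $ i) \<Longrightarrow> d $ i > 0 \<Longrightarrow> Y *v row i W = column i U"
proof -
  have le1: "column i U \<bullet> (Y *v row i W) \<le> 1" for i
    using contraction_inner_le[OF Y, of "column i U" "row i W"]
    by (simp add: norm_column_isometry[OF U] norm_row_coisometry[OF W])
  have le: "d $ i * (column i U \<bullet> (Y *v row i W)) \<le> d $ i" for i
    using mult_left_mono[OF le1 d] by simp
  show "(U ** diagm d ** W) \<bullet> Y \<le> (\<Sum>i\<in>UNIV. d $ i)"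
    unfolding inner_svd by (rule sum_mono) (rule le)
  assume eq: "(U ** diagm d ** W) \<bullet> Y = (\<Sum>i\<in>UNIV. d $ i)" and pos: "d $ i > 0"
  have "d $ i * (column i U \<bullet> (Y *v row i W)) = d $ i"
    using sum_mono_inv[OF eq[unfolded inner_svd]] le by simp
  then have "column i U \<bullet> (Y *v row i W) = 1" using pos by simp
  then show "Y *v row i W = column i U"
    by (intro contraction_unit_eq[OF Y] norm_column_isometry[OF U] norm_row_coisometry[OF W])
qed

text \<open>
  The polar factor \<open>U W\<close> of \<open>X = U diag(d) W\<close> attains the maximum.
\<close>

lemma nuclear_norm_attained:
  fixes X :: "('n1::{finite,linorder}, 'n2::{finite,linorder}) rmat"
  assumes le: "CARD('n1) \<le> CARD('n2)"
  shows "\<exists>Y. contraction Y \<and> X \<bullet> Y = nuclear_norm X"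
proof -
  obtain U W where X: "orthogonal_matrix U" "W ** transpose W = id_mat"
    "X = U ** diagm (sv_vec X) ** W" by (rule obtain_thin_SVD[OF le, of X])
  have U: "transpose U ** U = id_mat" using orthogonal_matrix_inverse[OF X(1)] by simp
  have "contraction (U ** W)"
  proof (rule contraction_mult)
    show "contraction U" using norm_isometry[OF U] by (simp add: contraction_def)
    show "contraction W" by (rule contraction_coisometry[OF X(2)])
  qed
  moreover have "(U ** diagm d ** W) \<bullet> (U ** W) = (\<Sum>i\<in>UNIV. d $ i)" for d :: "real^('n1::{finite,linorder})"
  proof -
    have "(U ** diagm d ** W) \<bullet> (U ** W) = diagm d \<bullet> ((transpose U ** U) ** (W ** transpose W))"
      by (simp only: inner_matrix_mult_right[of "U ** diagm d" W] inner_matrix_mult_left[of U] matrix_mul_assoc)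
    also have "\<dots> = diagm d \<bullet> id_mat" by (simp only: U X(2) matrix_mul_lid)
    finally show ?thesis by (simp add: inner_diagm Finite_Cartesian_Product.mat_def)
  qed
  ultimately show ?thesis using X(3) nuclear_norm_eq_sum[OF le] by metis
qed

lemma inner_le_nuclear_norm:
  fixes X :: "('n1::{finite,linorder}, 'n2::{finite,linorder}) rmat"
  assumes le: "CARD('n1) \<le> CARD('n2)" and Y: "contraction Y"
  shows "X \<bullet> Y \<le> nuclear_norm X"
proof -
  obtain U W where X: "orthogonal_matrix U" "W ** transpose W = id_mat"
    "X = U ** diagm (sv_vec X) ** W" by (rule obtain_thin_SVD[OF le, of X])
  show ?thesis
    unfolding nuclear_norm_eq_sum[OF le]
    by (subst X(3), rule contraction_attaining_pairs(1)[OF orthogonal_matrix_inverse(1)[OF X(1)] X(2) _ Y])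
      (rule ex_ordered_SVD_props(2)[OF le])
qed

lemma convex_on_nuclear_norm:
  assumes le: "CARD('n1) \<le> CARD('n2)"
  shows "convex_on UNIV (nuclear_norm :: ('n1::{finite,linorder}, 'n2::{finite,linorder}) rmat \<Rightarrow> real)"
  unfolding convex_on_def
proof (intro conjI ballI allI impI)
  fix X Z :: "('n1, 'n2) rmat" and u v :: real
  assume uv: "0 \<le> u" "0 \<le> v" "u + v = 1"
  obtain Y where Y: "contraction Y" "(u *\<^sub>R X + v *\<^sub>R Z) \<bullet> Y = nuclear_norm (u *\<^sub>R X + v *\<^sub>R Z)"
    using nuclear_norm_attained[OF le] by blast
  have "(u *\<^sub>R X + v *\<^sub>R Z) \<bullet> Y = u * (X \<bullet> Y) + v * (Z \<bullet> Y)" by (simp add: inner_add_left)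
  also have "\<dots> \<le> u * nuclear_norm X + v * nuclear_norm Z"
    using uv by (intro add_mono mult_left_mono inner_le_nuclear_norm[OF le Y(1)]) auto
  finally show "nuclear_norm (u *\<^sub>R X + v *\<^sub>R Z) \<le> u * nuclear_norm X + v * nuclear_norm Z"
    by (simp add: Y(2))
qed simp

lemma subdifferential_nuclear_norm:
  fixes X Y :: "('n1::{finite,linorder}, 'n2::{finite,linorder}) rmat"
  assumes le: "CARD('n1) \<le> CARD('n2)" and Y: "Y \<in> subdifferential nuclear_norm X"
  shows "contraction Y" "X \<bullet> Y = nuclear_norm X"
proof -
  have sub: "nuclear_norm Z \<ge> nuclear_norm X + Y \<bullet> (Z - X)" for Z
    using Y by (simp add: subdifferential_def)
  have ub: "nuclear_norm Z \<le> c" if "\<And>Y'. contraction Y' \<Longrightarrow> Z \<bullet> Y' \<le> c" for Z :: "('n1, 'n2) rmat" and c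
    using nuclear_norm_attained[OF le, of Z] that by metis
  \<comment> \<open>The points \<open>0\<close> and \<open>2 X\<close> of the ray through \<open>X\<close> give the two inequalities.\<close>
  have "nuclear_norm (0 :: ('n1, 'n2) rmat) \<le> 0" by (rule ub) simp
  moreover have "nuclear_norm (2 *\<^sub>R X) \<le> 2 * nuclear_norm X"
    by (rule ub) (simp add: inner_le_nuclear_norm[OF le])
  ultimately show eq: "X \<bullet> Y = nuclear_norm X"
    using sub[of 0] sub[of "2 *\<^sub>R X"] by (simp add: inner_diff_right inner_commute)
  then have dual: "Z \<bullet> Y \<le> nuclear_norm Z" for Z
    using sub[of Z] by (simp add: inner_diff_right inner_commute)
  show "contraction Y"
    unfolding contraction_def
  proof
    fix x
    \<comment> \<open>The rank one matrix \<open>(Y x) x\<^sup>T\<close> has nuclear norm at most \<open>norm (Y x) * norm x\<close> and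
      inner product \<open>(norm (Y x))\<^sup>2\<close> with \<open>Y\<close>.\<close>
    let ?Z = "\<chi> i j. (Y *v x) $ i * x $ j"
    have rank1: "?Z \<bullet> Y' = (Y *v x) \<bullet> (Y' *v x)" for Y'
      by (simp add: inner_vec_def matrix_vector_mult_def sum_distrib_left mult_ac)
    have "nuclear_norm ?Z \<le> norm (Y *v x) * norm x"
      by (rule ub) (simp add: rank1 contraction_inner_le)
    then have "norm (Y *v x) * norm (Y *v x) \<le> norm (Y *v x) * norm x"
      using dual[of ?Z] by (simp add: rank1 power2_norm_eq_inner[symmetric] power2_eq_square)
    then show "norm (Y *v x) \<le> norm x" by (cases "Y *v x = 0") auto
  qed
qed

text \<open>
  \<open>Y\<close> acts on the singular vectors of \<open>X\<close> with positive singular value as an isometry, with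
  singular value 1. The remaining ones, where \<open>X\<close> vanishes, can be replaced by singular vectors of
  \<open>Y\<close> on the complements.
\<close>

lemma ex_simultaneous_ordered_SVD:
  fixes X Y :: "('n1::{finite,linorder}, 'n2::{finite,linorder}) rmat"
  assumes le: "CARD('n1) \<le> CARD('n2)" and Y: "contraction Y" and eq: "X \<bullet> Y = nuclear_norm X"
  shows "ordered_SVDs X \<inter> ordered_SVDs Y \<noteq> {}"
proof -
  let ?m = "CARD('n1)" and ?n = "CARD('n2)"
  obtain u v t where s: "svd_system ((*v) X) UNIV UNIV u v t"
    using ex_svd_system[of "(*v) X" UNIV UNIV] le by (auto simp: dim_UNIV)
  have on: "orthonormal_seq ?m u" "orthonormal_seq ?n v" and t: "\<And>i. i < ?m \<Longrightarrow> 0 \<le> t i"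
    "\<And>i j. j \<le> i \<Longrightarrow> i < ?m \<Longrightarrow> t i \<le> t j"
    and Xv: "\<And>i. i < ?m \<Longrightarrow> X *v v i = t i *\<^sub>R u i"
    "\<And>i. ?m \<le> i \<Longrightarrow> i < ?n \<Longrightarrow> X *v v i = 0"
    using s by (auto simp: svd_system_def)
  note svX = ordered_SVD_of_orthonormal_seq[OF le on Xv t]
  let ?U = "columns_mat u" and ?W = "(rect_id :: ('n1,'n2) rmat) ** transpose (columns_mat v)"
  have X: "X = ?U ** diagm (sv_vec X) ** ?W" and oU: "orthogonal_matrix ?U" and oV: "orthogonal_matrix (columns_mat v :: ('n2,'n2) rmat)"
    using svX(1) by (auto simp: ordered_SVDs_iff)
  have row: "row i ?W = v (pos i)" for i
  proof -
    have "pos i < ?n" using pos_less_card[of i] le by linarith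
    then show ?thesis
      by (simp add: vec_eq_iff row_def matrix_matrix_mult_def rect_id_def transpose_def columns_mat_def
          if_distrib[of "\<lambda>x. x * _"] sum_pos_eq cong: if_cong)
  qed
  have col: "column i ?U = u (pos i)" for i
    by (simp add: vec_eq_iff column_def columns_mat_def)
  define r where "r = card {i. i < ?m \<and> t i > 0}"
  have r: "i < ?m \<Longrightarrow> t i > 0 \<longleftrightarrow> i < r" "r \<le> ?m" for i
    unfolding r_def by (rule down_closed_card; use t(2) in force)+
  \<comment> \<open>Equality in the duality forces \<open>Y\<close> and its transpose to exchange \<open>u i\<close> and
    \<open>v i\<close> for \<open>i < r\<close>, hence \<open>Y\<close> maps the complement \<open>S\<close> of the \<open>v i\<close> into the
    complement \<open>T\<close> of the \<open>u i\<close>.\<close>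
  have Yv: "Y *v v i = u i" if "i < r" for i
  proof -
    have i: "i < ?m" using that r(2) by simp
    have "Y *v row (unpos i) ?W = column (unpos i) ?U"
    proof (rule contraction_attaining_pairs(2)[OF orthogonal_matrix_inverse(1)[OF oU] thin_coisometry[OF le oV] _ Y])
      show "0 \<le> sv_vec X $ i" for i by (rule ex_ordered_SVD_props(2)[OF le])
      show "(?U ** diagm (sv_vec X) ** ?W) \<bullet> Y = (\<Sum>i\<in>UNIV. sv_vec X $ i)"
        using X eq nuclear_norm_eq_sum[OF le, of X] by simp
      show "0 < sv_vec X $ unpos i" using i that r(1) by (simp add: svX(2))
    qed
    then show ?thesis using i by (simp add: row col)
  qed
  have Yu: "transpose Y *v u i = v i" if "i < r" for i
  proof (rule contraction_unit_eq[OF contraction_transpose[OF Y]])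
    show "norm (v i) = 1" "norm (u i) = 1"
      using on that r(2) le by (auto simp: orthonormal_seq_def norm_eq_1)
    then show "v i \<bullet> (transpose Y *v u i) = 1"
      unfolding inner_matrix_vector transpose_transpose Yv[OF that] by (simp add: norm_eq_1)
  qed
  define S where "S = {x. \<forall>i<r. v i \<bullet> x = 0}"
  define T where "T = {y. \<forall>i<r. u i \<bullet> y = 0}"
  have dim: "dim S + r = ?n" "dim T + r = ?m"
    using dim_orthonormal_complement[OF on(2), of r] dim_orthonormal_complement[OF on(1), of r] r(2) le
    by (auto simp: S_def T_def)
  have "\<exists>u v t. svd_system ((*v) Y) S T u v t"
  proof (rule ex_svd_system)
    show "subspace S" "subspace T" by (auto simp: S_def T_def subspace_def inner_right_distrib)
    show "Y *v x \<in> T" if "x \<in> S" for x using that Yu by (simp add: T_def S_def inner_matrix_vector)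
    show "adjoint ((*v) Y) y \<in> S" if "y \<in> T" for y
      unfolding S_def adjoint_matrix mem_Collect_eq inner_matrix_vector transpose_transpose
      using that Yv by (simp add: T_def)
    show "dim T \<le> dim S" using dim le by linarith
  qed simp
  then obtain u' v' t' where s': "svd_system ((*v) Y) S T u' v' t'" by blast
  define u2 where "u2 i = (if i < r then u i else u' (i - r))" for i
  define v2 where "v2 i = (if i < r then v i else v' (i - r))" for i
  define t2 where "t2 i = (if i < r then 1 else t' (i - r))" for i
  have on2: "orthonormal_seq ?m u2" "orthonormal_seq ?n v2"
  proof -
    have "orthonormal_seq (r + dim T) u2" unfolding u2_def
      using orthonormal_seq_append[OF on(1) r(2), of "dim T" u'] s' by (simp add: svd_system_def T_def)
    then show "orthonormal_seq ?m u2" using dim(2) by (simp add: add.commute)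
    have "orthonormal_seq (r + dim S) v2" unfolding v2_def
      using orthonormal_seq_append[OF on(2), of r "dim S" v'] s' r(2) le by (simp add: svd_system_def S_def)
    then show "orthonormal_seq ?n v2" using dim(1) by (simp add: add.commute)
  qed
  \<comment> \<open>The values \<open>1\<close> come first in \<open>t2\<close>; this is decreasing because a contraction has
    no singular value above 1.\<close>
  have t'le: "t' i \<le> 1" if "i < dim T" for i
  proof -
    have "i < dim S" using that dim le by linarith
    then have "norm (u' i) = 1" "norm (v' i) = 1" "Y *v v' i = t' i *\<^sub>R u' i"
      using s' that by (auto simp: svd_system_def orthonormal_seq_def norm_eq_1)
    then have "t' i = u' i \<bullet> (Y *v v' i)" by (simp add: norm_eq_1)
    also have "\<dots> \<le> norm (u' i) * norm (v' i)" by (rule contraction_inner_le[OF Y])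
    finally show ?thesis by (simp add: \<open>norm (u' i) = 1\<close> \<open>norm (v' i) = 1\<close>)
  qed
  have "(columns_mat u2, columns_mat v2) \<in> ordered_SVDs Y"
  proof (rule ordered_SVD_of_orthonormal_seq(1)[OF le on2, of _ t2])
    show "Y *v v2 i = t2 i *\<^sub>R u2 i" if "i < ?m" for i
      using that s' Yv dim by (auto simp: u2_def v2_def t2_def svd_system_def)
    show "Y *v v2 i = 0" if "?m \<le> i" "i < ?n" for i
      using that s' r(2) dim by (auto simp: v2_def svd_system_def)
    show "0 \<le> t2 i" if "i < ?m" for i
      using that s' dim by (auto simp: t2_def svd_system_def)
    show "t2 i \<le> t2 j" if "j \<le> i" "i < ?m" for i j
      using that s' dim t'le by (auto simp: t2_def svd_system_def)
  qed
  moreover have "(columns_mat u2, columns_mat v2) \<in> ordered_SVDs X"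
  proof (rule ordered_SVD_of_orthonormal_seq(1)[OF le on2, of _ t])
    have XS: "X *v z = 0" if "z \<in> S" for z
    proof -
      have "t (pos i) * (v (pos i) \<bullet> z) = 0" for i :: 'n1
      proof (cases "pos i < r")
        case True then show ?thesis using that by (simp add: S_def)
      next
        case False
        then show ?thesis using r(1)[of "pos i"] t(1)[of "pos i"] by simp
      qed
      moreover have "(?W *v z) $ i = v (pos i) \<bullet> z" for i by (metis row row_inner)
      ultimately have "diagm (sv_vec X) *v (?W *v z) = 0"
        by (simp add: vec_eq_iff diagm_vec svX(2))
      then show ?thesis by (subst X) (simp add: matrix_vector_mul_assoc[symmetric])
    qed
    have v2S: "v2 i \<in> S" if "r \<le> i" "i < ?n" for i
      using that s' dim by (auto simp: v2_def svd_system_def)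
    show "X *v v2 i = t i *\<^sub>R u2 i" if "i < ?m" for i
    proof (cases "i < r")
      case True then show ?thesis using Xv(1)[OF that] by (simp add: u2_def v2_def)
    next
      case False
      then have "t i = 0" using r(1)[OF that] t(1)[OF that] by auto
      then show ?thesis using XS v2S False that le by simp
    qed
    show "X *v v2 i = 0" if "?m \<le> i" "i < ?n" for i
      using XS v2S that r(2) by simp
  qed (use t in auto)
  ultimately show ?thesis by blast
qed

section \<open>Positive semidefinite matrices and faces of the nuclear norm ball\<close>

definition psd :: "real^'n^'n \<Rightarrow> bool" where
  "psd P \<longleftrightarrow> transpose P = P \<and> (\<forall>x. 0 \<le> x \<bullet> (P *v x))"

text \<open>
  The right hand side is the trace of \<open>P\<close>, which is the sum of its singular values.
\<close>

lemma psd_inner_contraction_le: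
  fixes P :: "('n::{finite,linorder}, 'n) rmat"
  assumes P: "psd P" and G: "contraction G"
  shows "P \<bullet> G \<le> P \<bullet> id_mat"
proof -
  obtain U W d where UW: "orthogonal_matrix (U :: ('n,'n) rmat)" "W ** transpose W = id_mat"
    "P = U ** diagm d ** W" and d: "\<And>i. 0 \<le> d $ i"
    by (rule obtain_thin_SVD[OF order_refl, of P]) (metis ex_ordered_SVD_props(2)[OF order_refl])
  have U: "transpose U ** U = id_mat" using orthogonal_matrix_inverse[OF UW(1)] by simp
  \<comment> \<open>A left and a right singular vector of a positive semidefinite matrix agree unless the
    singular value is 0: the quadratic form at their difference is \<open>- d $ i\<close> times its squared
    length.\<close>
  have eq: "d $ i * (column i U \<bullet> (id_mat *v row i W)) = d $ i" for i
  proof (cases "d $ i = 0")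
    case False
    define u w where "u = column i U" and "w = row i W"
    have "P *v w = d $ i *\<^sub>R u" "P *v u = d $ i *\<^sub>R w"
      using svd_vectors[OF U UW(2), of d i] P by (simp_all only: UW(3)[symmetric] u_def w_def psd_def)
    then have "(u - w) \<bullet> (P *v (u - w)) = - (d $ i * ((u - w) \<bullet> (u - w)))"
      by (simp add: matrix_vector_mult_diff_distrib inner_diff algebra_simps)
    moreover have "0 \<le> (u - w) \<bullet> (P *v (u - w))" using P by (simp add: psd_def)
    moreover have "0 < d $ i" using False d[of i] by simp
    ultimately have "(u - w) \<bullet> (u - w) \<le> 0" by (simp add: mult_le_0_iff)
    then have "u = w" by (metis eq_iff_diff_eq_0 inner_eq_zero_iff inner_ge_zero order_antisym)
    moreover have "norm w = 1" using norm_row_coisometry[OF UW(2)] by (simp add: w_def)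
    ultimately show ?thesis by (simp add: u_def[symmetric] w_def[symmetric] norm_eq_1)
  qed simp
  have "P \<bullet> G \<le> (\<Sum>i\<in>UNIV. d $ i)"
    unfolding UW(3) by (rule contraction_attaining_pairs(1)[OF U UW(2) d G])
  also have "\<dots> = P \<bullet> id_mat"
    unfolding UW(3) inner_svd eq ..
  finally show ?thesis .
qed

lemma nuclear_norm_psd_le:
  fixes U P :: "('n1::{finite,linorder}, 'n1) rmat" and W :: "('n1, 'n2::{finite,linorder}) rmat"
  assumes le: "CARD('n1) \<le> CARD('n2)" and U: "transpose U ** U = id_mat"
    and W: "W ** transpose W = id_mat" and P: "psd P"
  shows "nuclear_norm (U ** P ** W) \<le> P \<bullet> id_mat"
proof -
  obtain Y where Y: "contraction Y" "(U ** P ** W) \<bullet> Y = nuclear_norm (U ** P ** W)"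
    using nuclear_norm_attained[OF le] by blast
  have "contraction (transpose U ** (Y ** transpose W))"
  proof (intro contraction_mult Y(1) contraction_transpose)
    show "contraction U" using norm_isometry[OF U] by (simp add: contraction_def)
    show "contraction W" by (rule contraction_coisometry[OF W])
  qed
  moreover have "(U ** P ** W) \<bullet> Y = P \<bullet> (transpose U ** (Y ** transpose W))"
    by (simp only: inner_matrix_mult_right[of "U ** P" W] inner_matrix_mult_left[of U])
  ultimately show ?thesis using psd_inner_contraction_le[OF P] Y(2) by metis
qed

text \<open>
  The matrices at which \<open>Y\<close> attains the nuclear norm. For such an \<open>X = \<Sum>i. d\<^sub>i u\<^sub>i w\<^sub>i\<^sup>T\<close> every pair with
  \<open>d\<^sub>i > 0\<close> satisfies \<open>Y w\<^sub>i = u\<^sub>i\<close>. As both vectors have length 1, this leaves only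
  \<open>u\<^sub>i = U a\<^sub>i\<close>, \<open>w\<^sub>i = W\<^sup>T a\<^sub>i\<close> with the same \<open>a\<^sub>i\<close>, supported where \<open>t = 1\<close>, and then
  \<open>P = \<Sum>i. d\<^sub>i a\<^sub>i a\<^sub>i\<^sup>T\<close>.
\<close>

lemma nuclear_norm_face:
  fixes U :: "('n1::{finite,linorder}, 'n1) rmat" and W X Y :: "('n1, 'n2::{finite,linorder}) rmat"
  assumes le: "CARD('n1) \<le> CARD('n2)" and U: "orthogonal_matrix U"
    and W: "W ** transpose W = id_mat" and Y: "Y = U ** diagm t ** W"
    and t: "\<And>i. 0 \<le> t $ i" "\<And>i. t $ i \<le> 1" and cY: "contraction Y"
    and eq: "X \<bullet> Y = nuclear_norm X"
  obtains P where "psd P" "X = U ** P ** W" "\<And>i j. P $ i $ j \<noteq> 0 \<Longrightarrow> t $ i = 1 \<and> t $ j = 1"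
proof -
  note UU = orthogonal_matrix_inverse[OF U]
  obtain U' W' d where UW: "orthogonal_matrix (U' :: ('n1,'n1) rmat)" "W' ** transpose W' = id_mat"
    "X = U' ** diagm d ** W'" and d: "\<And>i. 0 \<le> d $ i" and sum: "nuclear_norm X = (\<Sum>i\<in>UNIV. d $ i)"
    using obtain_thin_SVD[OF le, of X] ex_ordered_SVD_props(2)[OF le, of X] nuclear_norm_eq_sum[OF le, of X] by metis
  note UU' = orthogonal_matrix_inverse[OF UW(1)]
  define N where "N = W ** transpose W'"
  have col: "column i N = W *v row i W'" for i
    by (simp add: N_def vec_eq_iff matrix_vector_mult_def row_def column_def matrix_matrix_mult_def transpose_def)
  have key: "(\<forall>j. N $ j $ i = 0 \<or> t $ j = 1) \<and> column i U' = U *v column i N \<and> row i W' = transpose W *v column i N"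
    if "d $ i > 0" for i
  proof -
    define a where "a = W *v row i W'"
    \<comment> \<open>\<open>Y\<close> maps the unit vector \<open>w = row i W'\<close> to a unit vector, so neither \<open>W\<close> nor
      \<open>diagm t\<close> shortens it: \<open>a = W w\<close> is carried by the coordinates with \<open>t = 1\<close>.\<close>
    have Yr: "Y *v row i W' = column i U'"
      by (rule contraction_attaining_pairs(2)[OF UU'(1) UW(2) d cY _ that])
        (use eq sum UW(3) in simp)
    have u: "column i U' = U *v (diagm t *v a)"
      using Yr unfolding a_def Y by (simp add: matrix_vector_mul_assoc matrix_mul_assoc)
    have nw: "norm (row i W') = 1" by (rule norm_row_coisometry[OF UW(2)])
    have "norm a \<le> 1"
      using contraction_coisometry[OF W] nw unfolding contraction_def a_def by metis
    then have a1: "a \<bullet> a \<le> 1" by (simp add: power2_norm_eq_inner[symmetric] power_le_one)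
    have "norm (diagm t *v a) = 1"
      using u norm_isometry[OF UU(1)] norm_column_isometry[OF UU'(1)] by metis
    then have ta: "(diagm t *v a) \<bullet> (diagm t *v a) = 1" by (simp add: norm_eq_1)
    have "a \<bullet> a - (diagm t *v a) \<bullet> (diagm t *v a) = (\<Sum>j\<in>UNIV. (1 - (t $ j)\<^sup>2) * (a $ j)\<^sup>2)"
      unfolding inner_vec_def diagm_vec
      by (simp add: sum_subtractf[symmetric] power2_eq_square algebra_simps)
    then have le0: "(\<Sum>j\<in>UNIV. (1 - (t $ j)\<^sup>2) * (a $ j)\<^sup>2) \<le> 0" using a1 ta by linarith
    have nn: "0 \<le> (1 - (t $ j)\<^sup>2) * (a $ j)\<^sup>2" for j
      using t by (simp add: power_le_one)
    have "(\<Sum>j\<in>UNIV. (1 - (t $ j)\<^sup>2) * (a $ j)\<^sup>2) = 0"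
      using le0 by (intro antisym sum_nonneg nn)
    then have "(1 - (t $ j)\<^sup>2) * (a $ j)\<^sup>2 = 0" for j
      using nn by (subst (asm) sum_nonneg_eq_0_iff) auto
    then have aj: "a $ j = 0 \<or> t $ j = 1" for j
      using t(1)[of j] by (auto simp: power2_eq_1_iff) (metis not_one_le_zero neg_0_le_iff_le order_trans zero_le_one)
    then have Ta: "diagm t *v a = a" by (auto simp: vec_eq_iff diagm_vec)
    \<comment> \<open>\<open>W\<close> keeps the norm of \<open>w\<close>, so \<open>w\<close> lies in the range of \<open>W\<^sup>T\<close>.\<close>
    have "norm a = 1" using ta Ta by (simp add: norm_eq_1)
    then have "row i W' \<bullet> (transpose W *v a) = 1"
      unfolding inner_matrix_vector transpose_transpose a_def[symmetric] by (simp add: norm_eq_1)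
    then have "transpose W *v a = row i W'"
      using contraction_unit_eq[OF contraction_transpose[OF contraction_coisometry[OF W]] nw \<open>norm a = 1\<close>] by simp
    then show ?thesis using u Ta aj unfolding col a_def[symmetric]
      using col[of i] by (auto simp: a_def[symmetric] column_def vec_eq_iff)
  qed
  define P where "P = N ** diagm d ** transpose N"
  \<comment> \<open>The factor \<open>diagm d\<close> removes the columns with \<open>d $ i = 0\<close>, about which nothing is known.\<close>
  have l: "U' ** diagm d = U ** N ** diagm d"
  proof -
    have "(U' ** diagm d) $ a $ i = (U ** N ** diagm d) $ a $ i" for a i
    proof (cases "d $ i = 0")
      case False
      then have "column i U' = U *v column i N" using key[of i] d[of i] by simp
      moreover have "U *v column i N = column i (U ** N)"
        by (simp add: vec_eq_iff matrix_vector_mult_def column_def matrix_matrix_mult_def)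
      ultimately show ?thesis by (simp add: mult_diagm column_def vec_eq_iff)
    qed (simp add: mult_diagm)
    then show ?thesis by (simp add: vec_eq_iff)
  qed
  have r: "diagm d ** W' = diagm d ** (transpose N ** W)"
  proof -
    have "(diagm d ** W') $ i $ a = (diagm d ** (transpose N ** W)) $ i $ a" for a i
    proof (cases "d $ i = 0")
      case False
      then have "row i W' = transpose W *v column i N" using key[of i] d[of i] by simp
      moreover have "transpose W *v column i N = row i (transpose N ** W)"
        by (simp add: vec_eq_iff matrix_vector_mult_def vector_matrix_mult_def row_def column_def matrix_matrix_mult_def transpose_def mult_ac)
      ultimately show ?thesis by (simp add: diagm_mult row_def vec_eq_iff)
    qed (simp add: diagm_mult)
    then show ?thesis by (simp add: vec_eq_iff)
  qed
  have "X = U ** N ** (diagm d ** W')" unfolding UW(3) l by (simp add: matrix_mul_assoc)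
  then have X: "X = U ** P ** W" unfolding r P_def by (simp add: matrix_mul_assoc)
  have "psd P"
    unfolding psd_def
  proof (intro conjI allI)
    show "transpose P = P" by (simp add: P_def matrix_transpose_mul matrix_mul_assoc)
    fix x
    define y where "y = transpose N *v x"
    have "x \<bullet> (P *v x) = y \<bullet> (diagm d *v y)"
      unfolding P_def y_def by (simp only: matrix_vector_mul_assoc[symmetric] inner_matrix_vector)
    also have "\<dots> = (\<Sum>i\<in>UNIV. d $ i * (y $ i)\<^sup>2)"
      by (simp add: inner_vec_def diagm_vec power2_eq_square mult_ac)
    finally show "0 \<le> x \<bullet> (P *v x)" using d by (simp add: sum_nonneg)
  qed
  moreover have "t $ i = 1 \<and> t $ j = 1" if "P $ i $ j \<noteq> 0" for i j
  proof -
    have "P $ i $ j = (\<Sum>k\<in>UNIV. N $ i $ k * d $ k * N $ j $ k)"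
      unfolding P_def matrix_matrix_mult_def[of "N ** diagm d"] by (simp add: mult_diagm transpose_def)
    then have "(\<Sum>k\<in>UNIV. N $ i $ k * d $ k * N $ j $ k) \<noteq> 0" using that by metis
    from sum.not_neutral_contains_not_neutral[OF this]
    have "\<exists>k. N $ i $ k * d $ k * N $ j $ k \<noteq> 0" by metis
    then obtain k where "N $ i $ k * d $ k * N $ j $ k \<noteq> 0" ..
    then show ?thesis using key[of k] d[of k] by (auto simp: less_le)
  qed
  ultimately show ?thesis using that X by blast
qed

section \<open>Feasible directions of the positive semidefinite cone\<close>

lemma psd_kernel:
  assumes P: "psd P" and x: "x \<bullet> (P *v x) = 0" shows "P *v x = 0"
proof (rule ccontr)
  assume n: "P *v x \<noteq> 0"
  define y where "y = P *v x"
  define a where "a = y \<bullet> (P *v y)"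
  have s: "transpose P = P" using P by (simp add: psd_def)
  have "y \<bullet> y > 0" using n by (simp add: y_def)
  have a: "a \<ge> 0" using P by (simp add: a_def psd_def)
  have q: "0 \<le> e\<^sup>2 * a - 2 * e * (y \<bullet> y)" for e
  proof -
    have "0 \<le> (x - e *\<^sub>R y) \<bullet> (P *v (x - e *\<^sub>R y))" using P by (simp add: psd_def)
    also have "\<dots> = x \<bullet> (P *v x) - e * (x \<bullet> (P *v y)) - e * (y \<bullet> (P *v x)) + e\<^sup>2 * a"
      by (simp add: matrix_vector_mult_diff_distrib matrix_vector_mult_scaleR inner_diff a_def power2_eq_square algebra_simps)
    also have "x \<bullet> (P *v y) = y \<bullet> y" unfolding inner_matrix_vector s y_def ..
    finally show ?thesis using x by (simp add: y_def[symmetric])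
  qed
  \<comment> \<open>Moving from \<open>x\<close> by \<open>- e y\<close> changes the form by \<open>e\<^sup>2 a - 2 e (y \<bullet> y)\<close>, which is negative
    for this \<open>e\<close>.\<close>
  define e where "e = (y \<bullet> y) / (a + 1)"
  have e: "e > 0" "e * (a + 1) = y \<bullet> y" using \<open>y \<bullet> y > 0\<close> a by (auto simp: e_def)
  have "e * a \<le> y \<bullet> y" using e by (simp add: algebra_simps)
  then have "e * (e * a) \<le> e * (y \<bullet> y)" using e(1) by simp
  moreover have "0 < e * (y \<bullet> y)" using e(1) \<open>y \<bullet> y > 0\<close> by simp
  ultimately show False using q[of e] by (simp add: power2_eq_square algebra_simps)
qed

text \<open>
  The rows of \<open>L\<close> are orthogonal to the kernel of \<open>C\<close>, and the orthogonal complement of the kernel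
  of a symmetric matrix is its range.
\<close>

lemma left_factor_of_kernel_subset:
  fixes C :: "real^'n^'n" and L :: "real^'n^'m"
  assumes C: "transpose C = C" and ker: "\<And>y. C *v y = 0 \<Longrightarrow> L *v y = 0"
  shows "\<exists>B. L = B ** C"
proof -
  have lin: "linear ((*v) C)" by simp
  have "\<exists>b. row i L = C *v b" for i
  proof -
    have adj: "adjoint ((*v) C) = (*v) C" using C by (simp add: adjoint_matrix)
    have "{y. C *v y = 0} = orthogonal_comp (range ((*v) C))"
      using ker_orthogonal_comp_adjoint[OF lin] unfolding adj by auto
    then have "orthogonal_comp {y. C *v y = 0} = range ((*v) C)"
      by (simp add: orthogonal_comp_self linear_subspace_image[OF lin])
    moreover have "row i L \<in> orthogonal_comp {y. C *v y = 0}"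
      using ker by (auto simp: orthogonal_comp_def orthogonal_def inner_commute[of _ "row i L"] row_inner)
    ultimately show ?thesis by auto
  qed
  then obtain b where b: "\<And>i. row i L = C *v b i" by metis
  define B where "B = (\<chi> i. b i)"
  have "L $ i $ j = (B ** C) $ i $ j" for i j
  proof -
    have "L $ i $ j = (C *v b i) $ j" using b[of i] by (simp add: row_def vec_eq_iff)
    also have "\<dots> = (\<Sum>k\<in>UNIV. b i $ k * C $ k $ j)"
      using C by (simp add: matrix_vector_mult_def transpose_def vec_eq_iff mult_ac)
    finally show ?thesis by (simp add: B_def matrix_matrix_mult_def)
  qed
  then show ?thesis by (auto simp: vec_eq_iff)
qed

lemma psd_congruence: "psd P \<Longrightarrow> psd (S ** P ** transpose S)"
  unfolding psd_def
proof (elim conjE, intro conjI allI)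
  assume "transpose P = P" "\<forall>x. 0 \<le> x \<bullet> (P *v x)"
  then show "transpose (S ** P ** transpose S) = S ** P ** transpose S"
    by (simp add: matrix_transpose_mul matrix_mul_assoc)
  fix x
  have "x \<bullet> (S ** P ** transpose S *v x) = (transpose S *v x) \<bullet> (P *v (transpose S *v x))"
    by (simp only: matrix_vector_mul_assoc[symmetric] inner_matrix_vector)
  then show "0 \<le> x \<bullet> (S ** P ** transpose S *v x)" using \<open>\<forall>x. 0 \<le> x \<bullet> (P *v x)\<close> by simp
qed

definition coord_proj :: "'n set \<Rightarrow> real^'n^'n" where
  "coord_proj I = diagm (\<chi> i. if i \<in> I then 1 else 0)"

lemma transpose_coord_proj [simp]: "transpose (coord_proj I) = coord_proj I"
  by (simp add: coord_proj_def)

lemma coord_proj_nth: "coord_proj I $ i $ j = (if i = j \<and> i \<in> I then 1 else 0)"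
  by (simp add: coord_proj_def diagm_def)

lemma coord_proj_entries:
  "(coord_proj I ** A) $ i $ j = (if i \<in> I then A $ i $ j else 0)"
  "(B ** coord_proj J) $ k $ l = (if l \<in> J then B $ k $ l else 0)"
  by (simp_all add: coord_proj_def diagm_mult mult_diagm)

lemma coord_proj_absorb:
  "coord_proj I ** A ** coord_proj J = A \<longleftrightarrow> (\<forall>i j. A $ i $ j \<noteq> 0 \<longrightarrow> i \<in> I \<and> j \<in> J)"
  by (auto simp: vec_eq_iff coord_proj_entries)

text \<open>
  If \<open>C y = 0\<close> for the diagonal block \<open>C\<close> on \<open>J\<close>, the form of \<open>P\<close> vanishes at the part of \<open>y\<close>
  on \<open>J\<close>, so \<open>P\<close> maps this part to 0. Thus the off-diagonal block vanishes on the kernel of \<open>C\<close>.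
\<close>

lemma psd_block_factor:
  fixes P :: "real^'n^'n"
  assumes P: "psd P" and K: "I \<inter> J = {}" and supp: "\<And>i j. P $ i $ j \<noteq> 0 \<Longrightarrow> i \<in> I \<union> J \<and> j \<in> I \<union> J"
  obtains B C where "psd C" "coord_proj J ** C ** coord_proj J = C" "coord_proj I ** B ** coord_proj J = B"
    "P = coord_proj I ** P ** coord_proj I + B ** C + transpose (B ** C) + C"
proof -
  define R S where "R = coord_proj I" and "S = coord_proj J"
  have RS: "R ** R = R" "S ** S = S" "transpose R = R" "transpose S = S"
    by (auto simp: R_def S_def vec_eq_iff coord_proj_entries coord_proj_nth)
  have sP: "transpose P = P" using P by (simp add: psd_def)
  have eq: "P = R ** P ** R + R ** P ** S + S ** P ** R + S ** P ** S"
    using supp K by (auto simp: vec_eq_iff R_def S_def coord_proj_entries)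
  define C where "C = S ** P ** S"
  have pC: "psd C" using psd_congruence[OF P, of S] by (simp add: C_def RS)
  then have sC: "transpose C = C" by (simp add: psd_def)
  have "\<exists>B. R ** P ** S = B ** C"
  proof (rule left_factor_of_kernel_subset[OF sC])
    fix y assume "C *v y = 0"
    then have "(S *v y) \<bullet> (P *v (S *v y)) = 0"
      by (metis C_def RS(4) inner_matrix_vector inner_zero_right matrix_vector_mul_assoc)
    from psd_kernel[OF P this] show "R ** P ** S *v y = 0"
      by (simp add: matrix_vector_mul_assoc[symmetric])
  qed
  then obtain B0 where B0: "R ** P ** S = B0 ** C" by blast
  define B where "B = R ** B0 ** S"
  have SC: "S ** C = C" "C ** S = C" unfolding C_def using RS(2) by (metis matrix_mul_assoc)+
  have "B ** C = R ** (B0 ** C)" unfolding B_def by (metis SC(1) matrix_mul_assoc)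
  also have "\<dots> = R ** P ** S" unfolding B0[symmetric] by (metis RS(1) matrix_mul_assoc)
  finally have BC: "B ** C = R ** P ** S" .
  show ?thesis
  proof (rule that[OF pC, of B])
    show "coord_proj J ** C ** coord_proj J = C" unfolding S_def[symmetric] by (simp add: SC)
    show "coord_proj I ** B ** coord_proj J = B"
      unfolding S_def[symmetric] R_def[symmetric] B_def by (metis RS(1,2) matrix_mul_assoc)
    have "transpose (B ** C) = S ** P ** R" unfolding BC by (simp add: matrix_transpose_mul RS sP matrix_mul_assoc)
    then show "P = coord_proj I ** P ** coord_proj I + B ** C + transpose (B ** C) + C"
      unfolding BC R_def[symmetric] using eq by (simp add: C_def)
  qed
qed

text \<open>
  With \<open>N = A - B C B\<^sup>T\<close> the form of the direction at \<open>x\<close> is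
  \<open>x \<bullet> N x + (x + B\<^sup>T x) \<bullet> C (x + B\<^sup>T x)\<close>. The second term is nonnegative, and the first depends only
  on the coordinates in \<open>I\<close>, where \<open>diagm d\<close> dominates a small multiple of it.
\<close>

lemma psd_feasible_direction:
  fixes A B C :: "real^'n^'n"
  assumes A: "transpose A = A" "coord_proj I ** A ** coord_proj I = A"
    and B: "coord_proj I ** B = B" and C: "psd C"
    and d: "\<And>i. 0 \<le> d $ i" "\<And>i. i \<in> I \<Longrightarrow> 0 < d $ i"
  obtains t where "t > 0" "psd (diagm d + t *\<^sub>R (A + B ** C + transpose (B ** C) + C))"
proof -
  define R :: "real^'n^'n" where "R = coord_proj I"
  \<comment> \<open>The part of the direction that remains after completing the square.\<close>
  define N where "N = A - B ** C ** transpose B"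
  have sC: "transpose C = C" and pC: "\<And>x. 0 \<le> x \<bullet> (C *v x)" using C by (auto simp: psd_def)
  have RT: "transpose R = R" by (simp add: R_def)
  have "R ** N ** R = N"
  proof -
    have BR: "transpose B ** R = transpose B" using B RT by (metis R_def matrix_transpose_mul)
    have "R ** (B ** C ** transpose B) ** R = (R ** B) ** C ** (transpose B ** R)" by (simp add: matrix_mul_assoc)
    also have "\<dots> = B ** C ** transpose B" using B BR by (simp add: R_def)
    finally show ?thesis using A(2)
      unfolding N_def R_def coord_proj_absorb by (auto, (metis)+)
  qed
  then have NR: "x \<bullet> (N *v x) = (R *v x) \<bullet> (N *v (R *v x))" for x
    by (metis RT inner_matrix_vector matrix_vector_mul_assoc)
  obtain c where c: "c > 0" "\<And>x. norm (N *v x) \<le> c * norm x"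
    using linear_bounded_pos[of "(*v) N"] by auto
  have lo: "- c * (y \<bullet> y) \<le> y \<bullet> (N *v y)" for y
  proof -
    have "\<bar>y \<bullet> (N *v y)\<bar> \<le> norm y * norm (N *v y)" by (rule Cauchy_Schwarz_ineq2)
    also have "\<dots> \<le> norm y * (c * norm y)" using c by (intro mult_left_mono) auto
    also have "\<dots> = c * (y \<bullet> y)" by (simp add: power2_norm_eq_inner[symmetric] power2_eq_square)
    finally show ?thesis by linarith
  qed
  obtain e where e: "e > 0" "\<And>i. i \<in> I \<Longrightarrow> e \<le> d $ i"
  proof (cases "I = {}")
    case True then show ?thesis using that[of 1] by simp
  next
    case False
    have fin: "finite (($) d ` I)" by simp
    show ?thesis by (rule that[of "Min (($) d ` I)"]) (use False d(2) fin in auto)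
  qed
  have De: "e * ((R *v x) \<bullet> (R *v x)) \<le> x \<bullet> (diagm d *v x)" for x
  proof -
    have "e * ((R *v x) \<bullet> (R *v x)) = (\<Sum>i\<in>UNIV. e * (if i \<in> I then (x $ i)\<^sup>2 else 0))"
      unfolding R_def coord_proj_def inner_vec_def diagm_vec sum_distrib_left
      by (rule sum.cong) (auto simp: power2_eq_square)
    also have "\<dots> \<le> (\<Sum>i\<in>UNIV. d $ i * (x $ i)\<^sup>2)"
      using d(1) e by (intro sum_mono) (auto intro: mult_right_mono)
    also have "\<dots> = x \<bullet> (diagm d *v x)"
      by (simp add: inner_vec_def diagm_vec power2_eq_square mult_ac)
    finally show ?thesis .
  qed
  define t where "t = e / c"
  have t: "t > 0" "t * c = e" using e c by (auto simp: t_def)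
  define M where "M = A + B ** C + transpose (B ** C) + C"
  \<comment> \<open>The square completed with \<open>z = B\<^sup>T x\<close>.\<close>
  have quad: "x \<bullet> (M *v x) = x \<bullet> (N *v x) + (x + transpose B *v x) \<bullet> (C *v (x + transpose B *v x))" for x
  proof -
    define z where "z = transpose B *v x"
    have 1: "x \<bullet> ((B ** C) *v x) = z \<bullet> (C *v x)"
      by (simp only: matrix_vector_mul_assoc[symmetric] inner_matrix_vector z_def)
    have 2: "x \<bullet> (transpose (B ** C) *v x) = z \<bullet> (C *v x)"
      by (metis 1 inner_commute inner_matrix_vector transpose_transpose)
    have 3: "x \<bullet> (C *v z) = z \<bullet> (C *v x)" by (metis inner_commute inner_matrix_vector sC)
    have 4: "x \<bullet> (B ** C ** transpose B *v x) = z \<bullet> (C *v z)"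
      by (simp only: matrix_vector_mul_assoc[symmetric] inner_matrix_vector z_def)
    show ?thesis
      unfolding M_def N_def z_def[symmetric]
      using 1 2 3 4 by (simp only: matrix_vector_mult_add_rdistrib matrix_vector_mult_diff_rdistrib
        matrix_vector_right_distrib inner_add_left inner_add_right inner_diff_right)
  qed
  have "psd (diagm d + t *\<^sub>R M)"
    unfolding psd_def
  proof (intro conjI allI)
    have "transpose M = M"
      unfolding M_def using A(1) sC by (simp add: vec_eq_iff transpose_def add_ac)
    then show "transpose (diagm d + t *\<^sub>R M) = diagm d + t *\<^sub>R M"
      using transpose_diagm[of d] by (simp add: vec_eq_iff transpose_def)
    fix x
    let ?y = "R *v x"
    have "- c * (?y \<bullet> ?y) \<le> x \<bullet> (M *v x)"
      using lo[of ?y] NR[of x] quad[of x] pC[of "x + transpose B *v x"] by linarith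
    then have "t * (- c * (?y \<bullet> ?y)) \<le> t * (x \<bullet> (M *v x))"
      using t(1) by (intro mult_left_mono) auto
    moreover have "t * (- c * (?y \<bullet> ?y)) = - (e * (?y \<bullet> ?y))" using t(2) by (metis mult.assoc mult_minus_left mult_minus_right)
    moreover have "x \<bullet> ((diagm d + t *\<^sub>R M) *v x) = x \<bullet> (diagm d *v x) + t * (x \<bullet> (M *v x))"
      by (simp add: matrix_vector_mult_add_rdistrib inner_add_right scaleR_matrix_vector_assoc[symmetric])
    ultimately show "0 \<le> x \<bullet> ((diagm d + t *\<^sub>R M) *v x)" using De[of x] by linarith
  qed
  then show ?thesis using that t(1) unfolding M_def by blast
qed

section \<open>Blocks as matrices of fixed size\<close>

text \<open>
  Blocks have sizes that depend on \<open>r\<close> and \<open>p\<close>. Padded with zeros and placed with the upper left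
  corner at \<open>(i, j)\<close>, they all become square matrices of one type, in which products of matching
  blocks are ordinary products.
\<close>

definition embed_block :: "nat \<Rightarrow> nat \<Rightarrow> real Matrix.mat \<Rightarrow> ('n::{finite,linorder}, 'n) rmat" where
  "embed_block i j M = (\<chi> a b. if i \<le> pos a \<and> pos a < i + dim_row M \<and> j \<le> pos b \<and> pos b < j + dim_col M
     then M $$ (pos a - i, pos b - j) else 0)"

lemma embed_block_mult:
  assumes A: "A \<in> carrier_mat a b" and B: "B \<in> carrier_mat b c" and le: "k + b \<le> CARD('n)"
  shows "embed_block i k A ** embed_block k j B = (embed_block i j (A * B) :: ('n::{finite,linorder}, 'n) rmat)"
proof -
  have "(embed_block i k A ** embed_block k j B) $ x $ y = (embed_block i j (A * B) :: ('n, 'n) rmat) $ x $ y" for x y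
  proof (cases "i \<le> pos x \<and> pos x < i + a \<and> j \<le> pos y \<and> pos y < j + c")
    case True
    have "(embed_block i k A ** embed_block k j B) $ x $ y =
      (\<Sum>l\<in>(UNIV::'n set). if k \<le> pos l \<and> pos l < k + b
        then A $$ (pos x - i, pos l - k) * B $$ (pos l - k, pos y - j) else 0)"
      unfolding matrix_matrix_mult_def using True A B
      by (auto simp: embed_block_def intro!: sum.cong)
    also have "\<dots> = (\<Sum>l<b. A $$ (pos x - i, l) * B $$ (l, pos y - j))"
      by (rule sum_pos_window[OF le])
    also have "\<dots> = (A * B) $$ (pos x - i, pos y - j)"
      using True A B by (auto simp: scalar_prod_def atLeast0LessThan intro!: sum.cong)
    finally show ?thesis using True A B by (simp add: embed_block_def)
  next
    case False
    then have "(embed_block i k A :: ('n, 'n) rmat) $ x $ l * embed_block k j B $ l $ y = 0" for l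
      using A B by (auto simp: embed_block_def)
    then show ?thesis using False A B by (auto simp: matrix_matrix_mult_def embed_block_def)
  qed
  then show ?thesis by (simp add: vec_eq_iff)
qed

lemma transpose_embed_block: "transpose (embed_block i j A) = embed_block j i (transpose_mat A)"
  by (auto simp: vec_eq_iff transpose_def embed_block_def)

lemma embed_block_zero: "embed_block i j (0\<^sub>m a b) = 0"
  by (auto simp: vec_eq_iff embed_block_def)

lemma embed_block_inject:
  assumes "A \<in> carrier_mat a b" "B \<in> carrier_mat a b" "i + a \<le> CARD('n)" "j + b \<le> CARD('n)"
    and eq: "embed_block i j A = (embed_block i j B :: ('n::{finite,linorder}, 'n) rmat)"
  shows "A = B"
proof (rule eq_matI)
  fix x y assume "x < dim_row B" "y < dim_col B"
  then have "x < a" "y < b" using assms by auto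
  then show "A $$ (x, y) = B $$ (x, y)"
    using arg_cong[OF eq, of "\<lambda>M. M $ unpos (i + x) $ unpos (j + y)"] assms(1-4)
    by (simp add: embed_block_def)
qed (use assms in auto)

definition cut_block :: "nat \<Rightarrow> nat \<Rightarrow> nat \<Rightarrow> nat \<Rightarrow> ('n::{finite,linorder}, 'n) rmat \<Rightarrow> real Matrix.mat" where
  "cut_block i j a b M = Matrix.mat a b (\<lambda>(x, y). M $ unpos (i + x) $ unpos (j + y))"

lemma embed_cut_block:
  assumes "\<And>x y. M $ x $ y \<noteq> 0 \<Longrightarrow> i \<le> pos x \<and> pos x < i + a \<and> j \<le> pos y \<and> pos y < j + b"
  shows "embed_block i j (cut_block i j a b M) = M"
proof -
  have "embed_block i j (cut_block i j a b M) $ x $ y = M $ x $ y" for x y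
    using assms[of x y] by (auto simp: embed_block_def cut_block_def)
  then show ?thesis by (simp add: vec_eq_iff)
qed

lemma embed_block_quadratic:
  fixes y :: "real^('n::{finite,linorder})"
  assumes C: "C \<in> carrier_mat k k" and le: "r + k \<le> CARD('n)"
  defines "x \<equiv> Matrix.vec k (\<lambda>i. y $ unpos (r + i))"
  shows "y \<bullet> (embed_block r r C *v y) = scalar_prod x (C *\<^sub>v x)"
proof -
  have mv: "(embed_block r r C *v y) $ a =
      (if r \<le> pos a \<and> pos a < r + k then vec_index (C *\<^sub>v x) (pos a - r) else 0)" for a
  proof (cases "r \<le> pos a \<and> pos a < r + k")
    case True
    have "(embed_block r r C *v y) $ a = (\<Sum>b\<in>(UNIV::'n set). if r \<le> pos b \<and> pos b < r + k
        then C $$ (pos a - r, pos b - r) * y $ unpos (r + (pos b - r)) else 0)"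
      unfolding matrix_vector_mult_def vec_lambda_beta
      using True C by (intro sum.cong refl) (auto simp: embed_block_def)
    also have "\<dots> = (\<Sum>j<k. C $$ (pos a - r, j) * y $ unpos (r + j))"
      by (rule sum_pos_window[OF le])
    also have "\<dots> = vec_index (C *\<^sub>v x) (pos a - r)"
      using True C by (auto simp: x_def scalar_prod_def atLeast0LessThan intro!: sum.cong)
    finally show ?thesis using True by simp
  next
    case False
    then show ?thesis using C by (auto simp: matrix_vector_mult_def embed_block_def)
  qed
  have "y \<bullet> (embed_block r r C *v y) = (\<Sum>a\<in>(UNIV::'n set). if r \<le> pos a \<and> pos a < r + k
      then y $ unpos (r + (pos a - r)) * vec_index (C *\<^sub>v x) (pos a - r) else 0)"
    unfolding inner_vec_def mv by (auto intro!: sum.cong)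
  also have "\<dots> = (\<Sum>i<k. y $ unpos (r + i) * vec_index (C *\<^sub>v x) i)"
    by (rule sum_pos_window[OF le])
  also have "\<dots> = scalar_prod x (C *\<^sub>v x)"
    using C by (auto simp: x_def scalar_prod_def atLeast0LessThan intro!: sum.cong)
  finally show ?thesis .
qed

lemma psd_mats_iff_psd_embed_block:
  assumes C: "C \<in> carrier_mat k k" and le: "r + k \<le> CARD('n)"
  shows "C \<in> psd_mats k \<longleftrightarrow> psd (embed_block r r C :: ('n::{finite,linorder}, 'n) rmat)"
proof -
  have sym: "transpose_mat C = C \<longleftrightarrow> transpose (embed_block r r C) = (embed_block r r C :: ('n, 'n) rmat)"
    using embed_block_inject[of "transpose_mat C" k k C r r] C le by (auto simp: transpose_embed_block)
  have "(\<forall>x \<in> carrier_vec k. 0 \<le> scalar_prod x (C *\<^sub>v x)) \<longleftrightarrow>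
    (\<forall>y :: real^('n::{finite,linorder}). 0 \<le> y \<bullet> (embed_block r r C *v y))" (is "?l = ?r")
  proof
    show ?r if ?l using that by (simp add: embed_block_quadratic[OF C le])
    show ?l if ?r
    proof
      fix x assume x: "(x :: real Matrix.vec) \<in> carrier_vec k"
      define y :: "real^('n::{finite,linorder})" where "y = (\<chi> a. vec_index x (pos a - r))"
      have "Matrix.vec k (\<lambda>i. y $ unpos (r + i)) = x"
        using x le by (intro eq_vecI) (auto simp: y_def)
      then show "0 \<le> scalar_prod x (C *\<^sub>v x)"
        using \<open>?r\<close>[rule_format, of y] embed_block_quadratic[OF C le, of y] by simp
    qed
  qed
  then show ?thesis using C sym by (simp add: psd_mats_def sym_mats_def psd_def)
qed

text \<open>
  Factoring the rectangular certificate block through the rectangular identity \<open>J\<close> brings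
  \<open>U M V\<^sup>T\<close> into the form \<open>U K W\<close> with a square matrix \<open>K\<close> and \<open>W = J V\<^sup>T\<close>.
\<close>

lemma of_jnf_certificate_block:
  assumes le: "CARD('n1) \<le> CARD('n2)" and rp: "r \<le> p" "p \<le> CARD('n1)"
    and A: "A \<in> carrier_mat r r" and B: "B \<in> carrier_mat r (p - r)" and C: "C \<in> carrier_mat (p - r) (p - r)"
  defines "BC \<equiv> embed_block 0 r B ** embed_block r r C"
  shows "(of_jnf_mat (certificate_block CARD('n1) CARD('n2) p A B C) :: ('n1::{finite,linorder}, 'n2::{finite,linorder}) rmat)
    = (embed_block 0 0 A + BC + transpose BC + embed_block r r C) ** rect_id"
proof -
  have BC: "BC = embed_block 0 r (B * C)"
    unfolding BC_def by (rule embed_block_mult[OF B C]) (use rp in simp)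
  have D: "B * C \<in> carrier_mat r (p - r)" using B C by simp
  let ?K = "embed_block 0 0 A + BC + transpose BC + embed_block r r C"
  have cb: "certificate_block CARD('n1) CARD('n2) p A B C =
     four_block_mat
       (four_block_mat A (B * C) (transpose_mat (B * C)) C) (0\<^sub>m p (CARD('n2) - p))
       (0\<^sub>m (CARD('n1) - p) p) (0\<^sub>m (CARD('n1) - p) (CARD('n2) - p))"
    unfolding certificate_block_def using transpose_mult[OF B C] by simp
  have K: "(?K ** rect_id) $ x $ y = (if pos y < CARD('n1) then ?K $ x $ unpos (pos y) else 0)" for x :: 'n1 and y :: 'n2
  proof -
    have "(?K ** rect_id) $ x $ y = (\<Sum>k\<in>UNIV. if pos y = pos k then ?K $ x $ k else 0)"
      unfolding matrix_matrix_mult_def by (auto simp: rect_id_def intro!: sum.cong)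
    then show ?thesis by (simp add: sum_pos_eq)
  qed
  have "of_jnf_mat (certificate_block CARD('n1) CARD('n2) p A B C) $ x $ y = (?K ** rect_id) $ x $ y" for x :: 'n1 and y :: 'n2
  proof -
    have "pos x < CARD('n1)" "pos y < CARD('n2)" by simp_all
    then have xy: "pos x < r + (p - r) + (CARD('n1) - p)" "pos y < r + (p - r) + (CARD('n2) - p)"
      "pos x < p \<or> pos x - p < CARD('n1) - p" "pos y < p \<or> pos y - p < CARD('n2) - p"
      using rp le by linarith+
    have K': "(?K ** rect_id) $ x $ y = (if pos x < p \<and> pos y < p then
       (if pos x < r then if pos y < r then A $$ (pos x, pos y) else (B * C) $$ (pos x, pos y - r)
        else if pos y < r then (B * C) $$ (pos y, pos x - r) else C $$ (pos x - r, pos y - r)) else 0)"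
      unfolding K using A C D rp by (auto simp: BC embed_block_def transpose_def)
    show ?thesis
      unfolding K' cb of_jnf_mat_def using xy A C D rp by (auto simp: index_mat_four_block)
  qed
  then show ?thesis by (simp add: vec_eq_iff)
qed

section \<open>Existence of a dual certificate\<close>

lemma inner_range_adjoint:
  fixes \<Phi> :: "'a::euclidean_space \<Rightarrow> 'b::euclidean_space"
  assumes "linear \<Phi>" "y \<in> range (adjoint \<Phi>)" "\<Phi> x = \<Phi> x'"
  shows "x \<bullet> y = x' \<bullet> y"
  using assms by (auto simp: adjoint_works)

text \<open>
  The strict epigraph of \<open>f\<close> is disjoint from the points of the feasible set at height \<open>f x0\<close>.
  A separating hyperplane yields a subgradient that is orthogonal to the kernel of \<open>\<Phi>\<close>, hence lies
  in the range of the adjoint.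
\<close>

lemma ex_dual_certificate:
  fixes f :: "'a::euclidean_space \<Rightarrow> real" and \<Phi> :: "'a \<Rightarrow> 'b::euclidean_space"
  assumes f: "convex_on UNIV f" and \<Phi>: "linear \<Phi>" and min: "\<And>x. \<Phi> x = \<Phi> x0 \<Longrightarrow> f x0 \<le> f x"
  shows "subdifferential f x0 \<inter> range (adjoint \<Phi>) \<noteq> {}"
proof -
  define S where "S = {z :: 'a \<times> real. f (fst z) < snd z}"
  define T where "T = {z :: 'a \<times> real. \<Phi> (fst z) = \<Phi> x0 \<and> snd z = f x0}"
  have "convex S"
    unfolding convex_def
  proof (intro ballI allI impI)
    fix z w :: "'a \<times> real" and u v :: real
    assume *: "z \<in> S" "w \<in> S" "0 \<le> u" "0 \<le> v" "u + v = 1"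
    have "f (u *\<^sub>R fst z + v *\<^sub>R fst w) \<le> u * f (fst z) + v * f (fst w)"
      using f * by (simp add: convex_on_def)
    also have "\<dots> < u * snd z + v * snd w"
    proof (cases "u = 0")
      case True then show ?thesis using * by (simp add: S_def)
    next
      case False
      then show ?thesis using * by (intro add_less_le_mono mult_strict_left_mono mult_left_mono) (auto simp: S_def)
    qed
    finally show "u *\<^sub>R z + v *\<^sub>R w \<in> S" by (simp add: S_def)
  qed
  moreover have "convex T"
    unfolding convex_def T_def using \<Phi>
    by (auto simp: linear_add linear_scale scaleR_left_distrib[symmetric] distrib_right[symmetric])
  moreover have "(x0, f x0 + 1) \<in> S" "(x0, f x0) \<in> T" by (auto simp: S_def T_def)
  moreover have "T \<inter> S = {}" using min by (fastforce simp: S_def T_def)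
  ultimately obtain a b where a: "a \<noteq> 0" "\<And>z. z \<in> T \<Longrightarrow> a \<bullet> z \<le> b" "\<And>z. z \<in> S \<Longrightarrow> b \<le> a \<bullet> z"
    using separating_hyperplane_sets[of T S] by blast
  obtain g c where gc: "a = (g, c)" by fastforce
  have upper: "g \<bullet> x + c * f x0 \<le> b" if "\<Phi> x = \<Phi> x0" for x
    using a(2)[of "(x, f x0)"] that by (simp add: gc T_def)
  have lower: "b \<le> g \<bullet> x + c * s" if "f x < s" for x s
    using a(3)[of "(x, s)"] that by (simp add: gc S_def)
  have c0: "0 \<le> c"
    using lower[of x0 "f x0 + 1"] upper[of x0] by (simp add: algebra_simps)
  \<comment> \<open>The separating hyperplane is not vertical, since \<open>f\<close> is finite everywhere.\<close>
  have "c \<noteq> 0"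
  proof
    assume "c = 0"
    then have "g \<bullet> x0 \<le> g \<bullet> x" for x using upper[of x0] lower[of x "f x + 1"] by simp
    from this[of "x0 - g"] have "g \<bullet> g \<le> 0" by (simp add: inner_diff_right)
    then have "g = 0" by (metis inner_eq_zero_iff inner_ge_zero order_antisym)
    then show False using a(1) gc \<open>c = 0\<close> by (simp add: zero_prod_def)
  qed
  then have c: "c > 0" using c0 by simp
  have low: "b \<le> g \<bullet> x + c * f x" for x
  proof (rule field_le_epsilon)
    fix e :: real assume "e > 0"
    then show "b \<le> g \<bullet> x + c * f x + e" using lower[of x "f x + e / c"] c by (simp add: algebra_simps)
  qed
  define y where "y = - (inverse c) *\<^sub>R g"
  have gy: "g = - c *\<^sub>R y" using c by (simp add: y_def)
  have "y \<in> subdifferential f x0"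
    unfolding subdifferential_def mem_Collect_eq
  proof
    fix z
    have "g \<bullet> x0 + c * f x0 \<le> g \<bullet> z + c * f z" using upper[of x0] low[of z] by simp
    then have "c * (f x0 + y \<bullet> (z - x0)) \<le> c * f z" unfolding gy by (simp add: inner_diff_right algebra_simps)
    then show "f x0 + y \<bullet> (z - x0) \<le> f z" using c by simp
  qed
  moreover have "y \<in> range (adjoint \<Phi>)"
  proof -
    \<comment> \<open>\<open>g\<close> is bounded above on a translate of the kernel of \<open>\<Phi>\<close>, so it vanishes on that kernel.\<close>
    have le: "g \<bullet> h \<le> 0" if "\<Phi> h = 0" for h
      using upper[of "x0 + h"] low[of x0] that \<Phi> by (simp add: linear_add inner_add_right)
    have "g \<bullet> h = 0" if "\<Phi> h = 0" for h
      using le[OF that] le[of "- h"] that \<Phi> by (simp add: linear_neg)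
    then have "y \<in> orthogonal_comp (\<Phi> -` {0})"
      by (auto simp: orthogonal_comp_def orthogonal_def y_def inner_commute)
    also have "\<dots> = range (adjoint \<Phi>)"
      by (simp add: ker_orthogonal_comp_adjoint[OF \<Phi>] orthogonal_comp_self
          linear_subspace_image[OF adjoint_linear[OF \<Phi>]])
    finally show ?thesis .
  qed
  ultimately show ?thesis by blast
qed

section \<open>Uniqueness at a single certificate\<close>

text \<open>
  The sizes in the block matrix have their intended meaning: the first \<open>r\<close> coordinates carry the
  positive singular values of \<open>X\<close>, and the first \<open>p\<close> the singular values 1 of \<open>Y\<close>. They satisfy
  \<open>r \<le> p\<close> because a pair of singular vectors with a positive singular value of \<open>X\<close> has the singular
  value 1 for \<open>Y\<close>.
\<close>

lemma certificate_structure: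
  fixes X Y :: "('n1::{finite,linorder}, 'n2::{finite,linorder}) rmat"
  assumes le: "CARD('n1) \<le> CARD('n2)" and Y: "Y \<in> subdifferential nuclear_norm X"
    and UV: "(U, V) \<in> ordered_SVDs X" "(U, V) \<in> ordered_SVDs Y"
  defines "r \<equiv> rank X" and "p \<equiv> num_unit_singular_values Y"
  shows "sv_vec X $ i > 0 \<longleftrightarrow> pos i < r" "sv_vec Y $ i = 1 \<longleftrightarrow> pos i < p" "sv_vec Y $ i \<le> 1"
    "r \<le> p" "p \<le> CARD('n1)"
proof -
  define W where "W = (rect_id :: ('n1, 'n2) rmat) ** transpose V"
  note cY = subdifferential_nuclear_norm[OF le Y]
  have oU: "orthogonal_matrix U" and oV: "orthogonal_matrix V"
    and X: "X = U ** diagm (sv_vec X) ** W" and Y': "Y = U ** diagm (sv_vec Y) ** W"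
    using UV by (auto simp: ordered_SVDs_iff W_def)
  note U = orthogonal_matrix_inverse(1)[OF oU]
  have W: "W ** transpose W = id_mat"
    unfolding W_def by (rule thin_coisometry[OF le oV])
  note svX = ex_ordered_SVD_props(2,3)[OF le, where X=X]
  note svY = ex_ordered_SVD_props(2,3)[OF le, where X=Y]
  have Yrow: "Y *v row i W = sv_vec Y $ i *\<^sub>R column i U" for i
    using svd_vectors(1)[OF U W, of "sv_vec Y" i] Y' by simp
  have nc: "norm (column i U) = 1" for i by (rule norm_column_isometry[OF U])
  have le1: "sv_vec Y $ i \<le> 1" for i
  proof -
    have "norm (Y *v row i W) \<le> norm (row i W)" using cY(1) by (simp add: contraction_def)
    then show ?thesis by (simp add: Yrow nc norm_row_coisometry[OF W] svY(1))
  qed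
  then show "sv_vec Y $ i \<le> 1" .
  have one: "sv_vec Y $ i = 1" if "sv_vec X $ i > 0" for i
  proof -
    have "Y *v row i W = column i U"
      by (rule contraction_attaining_pairs(2)[OF U W svX(1) cY(1) _ that])
        (use X cY(2) nuclear_norm_eq_sum[OF le, of X] in simp)
    then have "norm (sv_vec Y $ i *\<^sub>R column i U) = 1" by (simp add: Yrow nc)
    then show ?thesis by (simp add: nc svY(1))
  qed
  have "rank X = rank (diagm (sv_vec X))" by (subst X) (rule rank_svd[OF U W])
  then have r: "r = card {i. sv_vec X $ i > 0}"
    using svX(1) by (simp add: r_def rank_diagm less_le)
  show "sv_vec X $ i > 0 \<longleftrightarrow> pos i < r" for i
    unfolding r by (rule down_closed_pos) (use svX(2) less_le_trans in blast)
  have "{i. i < CARD('n1) \<and> singular_values Y ! i = 1} = pos ` {i. sv_vec Y $ i = 1}"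
  proof (intro equalityI subsetI)
    fix k assume "k \<in> {i. i < CARD('n1) \<and> singular_values Y ! i = 1}"
    then show "k \<in> pos ` {i. sv_vec Y $ i = 1}"
      by (intro image_eqI[of _ _ "unpos k"]) (auto simp: sv_vec_def)
  qed (auto simp: sv_vec_def)
  then have p: "p = card {i. sv_vec Y $ i = 1}"
    by (simp add: p_def num_unit_singular_values_def card_image inj_on_def)
  show "sv_vec Y $ i = 1 \<longleftrightarrow> pos i < p" for i
    unfolding p by (rule down_closed_pos) (use svY(2) le1 order_antisym in metis)
  show "r \<le> p" unfolding r p by (rule card_mono) (auto intro: one)
  have "card {i. sv_vec Y $ i = 1} \<le> card (UNIV :: 'n1 set)" by (rule card_mono) auto
  then show "p \<le> CARD('n1)" by (simp add: p)
qed

text \<open>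
  A solution \<open>A\<close>, \<open>B\<close>, \<open>C\<close> of the system gives a direction \<open>K\<close> such that \<open>P = D + t K\<close> is
  positive semidefinite for some \<open>t > 0\<close>. Then \<open>U P W\<close> is feasible and its nuclear norm is at most the trace of \<open>P\<close>,
  which equals its inner product with \<open>Y\<close> and so the optimal value. By uniqueness \<open>K = 0\<close>.
\<close>

lemma certificate_implication_if_unique:
  fixes \<Phi> :: "('n1::{finite,linorder}, 'n2::{finite,linorder}) rmat \<Rightarrow> real^'m"
  assumes le: "CARD('n1) \<le> CARD('n2)" and lin: "linear \<Phi>" and Y: "Y \<in> certificate_set \<Phi> X0"
    and uniq: "\<And>X. \<Phi> X = \<Phi> X0 \<Longrightarrow> nuclear_norm X \<le> nuclear_norm X0 \<Longrightarrow> X = X0"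
  shows "certificate_implication \<Phi> X0 Y"
  unfolding certificate_implication_def Let_def
proof (intro ballI, clarify)
  let ?r = "rank X0" and ?p = "num_unit_singular_values Y"
  fix U V A B C
  assume UVX: "(U, V) \<in> ordered_SVDs X0" and UVY: "(U, V) \<in> ordered_SVDs Y"
    and A: "A \<in> sym_mats ?r" and B: "B \<in> carrier_mat ?r (?p - ?r)" and C: "C \<in> psd_mats (?p - ?r)"
    and ker: "\<Phi> (U ** of_jnf_mat (certificate_block CARD('n1) CARD('n2) ?p A B C) ** transpose V) = 0"
  have Ys: "Y \<in> subdifferential nuclear_norm X0" and Yr: "Y \<in> range (adjoint \<Phi>)"
    using Y by (auto simp: certificate_set_def)
  note cs = certificate_structure[OF le Ys UVX UVY]
  note cY = subdifferential_nuclear_norm[OF le Ys]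
  define W where "W = (rect_id :: ('n1, 'n2) rmat) ** transpose V"
  have oU: "orthogonal_matrix U" and oV: "orthogonal_matrix V"
    and X0: "X0 = U ** diagm (sv_vec X0) ** W" and Y': "Y = U ** diagm (sv_vec Y) ** W"
    using UVX UVY by (auto simp: ordered_SVDs_iff W_def)
  note U = orthogonal_matrix_inverse(1)[OF oU]
  have W: "W ** transpose W = id_mat"
    unfolding W_def by (rule thin_coisometry[OF le oV])
  have Ac: "A \<in> carrier_mat ?r ?r" and As: "transpose_mat A = A"
    and Cc: "C \<in> carrier_mat (?p - ?r) (?p - ?r)"
    using A C by (auto simp: sym_mats_def psd_mats_def)
  define A' where "A' = (embed_block 0 0 A :: ('n1, 'n1) rmat)"
  define B' where "B' = (embed_block 0 ?r B :: ('n1, 'n1) rmat)"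
  define C' where "C' = (embed_block ?r ?r C :: ('n1, 'n1) rmat)"
  define K where "K = A' + B' ** C' + transpose (B' ** C') + C'"
  have blk: "of_jnf_mat (certificate_block CARD('n1) CARD('n2) ?p A B C) = K ** (rect_id :: ('n1, 'n2) rmat)"
    using of_jnf_certificate_block[OF le cs(4,5) Ac B Cc] by (simp add: K_def A'_def B'_def C'_def)
  have ker': "\<Phi> (U ** K ** W) = 0" using ker unfolding blk W_def by (simp add: matrix_mul_assoc)
  have psdC: "psd C'" using C psd_mats_iff_psd_embed_block[OF Cc, of ?r] cs(4,5) by (simp add: C'_def)
  define I where "I = {i :: 'n1. pos i < ?r}"
  obtain t where t: "t > 0" "psd (diagm (sv_vec X0) + t *\<^sub>R K)"
  proof (rule psd_feasible_direction[of A' I B' C' "sv_vec X0"])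
    show "transpose A' = A'" by (simp add: A'_def transpose_embed_block As)
    show "coord_proj I ** A' ** coord_proj I = A'"
      unfolding coord_proj_absorb using Ac by (auto simp: A'_def embed_block_def I_def)
    show "coord_proj I ** B' = B'"
      using B by (auto simp: vec_eq_iff coord_proj_entries B'_def embed_block_def I_def)
    show "0 \<le> sv_vec X0 $ i" for i by (rule ex_ordered_SVD_props(2)[OF le])
    show "0 < sv_vec X0 $ i" if "i \<in> I" for i using that cs(1) by (simp add: I_def)
  qed (use psdC K_def in auto)
  define P where "P = diagm (sv_vec X0) + t *\<^sub>R K"
  define X where "X = U ** P ** W"
  have XX: "X = X0 + t *\<^sub>R (U ** K ** W)"
    unfolding X_def P_def matrix_mult_affine X0[symmetric] ..
  have \<Phi>X: "\<Phi> X = \<Phi> X0" using lin ker' by (simp add: XX linear_add linear_scale)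
  \<comment> \<open>\<open>P\<close> lives on the coordinates where the singular values of \<open>Y\<close> equal 1.\<close>
  have PT: "P ** diagm (sv_vec Y) = P"
  proof -
    have "sv_vec Y $ j = 1" if "P $ i $ j \<noteq> 0" for i j
    proof -
      have "pos j < ?p"
      proof (rule ccontr)
        assume n: "\<not> pos j < ?p"
        have "C' $ k $ j = 0" for k using n Cc cs(4) by (auto simp: C'_def embed_block_def)
        moreover have "(B' ** C') $ i $ j = 0" using calculation by (simp add: matrix_matrix_mult_def)
        moreover have "B' $ j $ k = 0" "A' $ i $ j = 0" for k
          using n cs(4) B Ac by (auto simp: B'_def A'_def embed_block_def)
        moreover have "(B' ** C') $ j $ i = 0" using calculation by (simp add: matrix_matrix_mult_def)
        ultimately have "K $ i $ j = 0" by (simp add: K_def transpose_def)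
        moreover have "diagm (sv_vec X0) $ i $ j = 0"
          using n cs(1)[of j] cs(4) ex_ordered_SVD_props(2)[OF le, where X=X0 and i=j] by (auto simp: diagm_def)
        ultimately show False using that by (simp add: P_def)
      qed
      then show ?thesis using cs(2) by simp
    qed
    then show ?thesis by (auto simp: vec_eq_iff mult_diagm)
  qed
  have XY: "X \<bullet> Y = P \<bullet> id_mat"
  proof -
    have "X \<bullet> Y = P \<bullet> (transpose U ** (Y ** transpose W))"
      unfolding X_def by (simp only: inner_matrix_mult_right[of "U ** P" W] inner_matrix_mult_left[of U])
    also have "transpose U ** (Y ** transpose W) = (transpose U ** U) ** diagm (sv_vec Y) ** (W ** transpose W)"
      by (subst Y') (simp add: matrix_mul_assoc)
    also have "\<dots> = id_mat ** transpose (diagm (sv_vec Y))" by (simp add: U W)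
    also have "P \<bullet> \<dots> = (P ** diagm (sv_vec Y)) \<bullet> id_mat"
      by (rule inner_matrix_mult_right[symmetric])
    finally show ?thesis by (simp add: PT)
  qed
  have "nuclear_norm X \<le> P \<bullet> id_mat"
    unfolding X_def by (rule nuclear_norm_psd_le[OF le U W]) (use t(2) P_def in simp)
  also have "\<dots> = nuclear_norm X0"
    using XY cY(2) inner_range_adjoint[OF lin Yr \<Phi>X] by simp
  finally have "X = X0" by (rule uniq[OF \<Phi>X])
  then have "U ** K ** W = 0" using t(1) by (simp add: XX)
  then have "transpose U ** (U ** K ** W) ** transpose W = 0" by simp
  moreover have "transpose U ** (U ** K ** W) ** transpose W = (transpose U ** U) ** K ** (W ** transpose W)"
    by (simp add: matrix_mul_assoc)
  ultimately have K0: "K = 0" by (simp add: U W)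
  \<comment> \<open>\<open>C'\<close> is the lower right block of \<open>K\<close>, and without it only \<open>A'\<close> remains.\<close>
  have C0: "C' = 0"
  proof -
    have "C' $ i $ j = K $ i $ j" if "\<not> pos i < ?r" "\<not> pos j < ?r" for i j
    proof -
      have "B' $ i $ k = 0" "B' $ j $ k = 0" "A' $ i $ j = 0" for k using that B Ac by (auto simp: B'_def A'_def embed_block_def)
      then show ?thesis by (simp add: K_def transpose_def matrix_matrix_mult_def)
    qed
    moreover have "C' $ i $ j = 0" if "pos i < ?r \<or> pos j < ?r" for i j
      using that Cc by (auto simp: C'_def embed_block_def)
    ultimately show ?thesis using K0 by (metis vec_eq_iff zero_index)
  qed
  then have A0: "A' = 0" using K0 by (simp add: K_def vec_eq_iff transpose_def matrix_matrix_mult_def)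
  have "A = 0\<^sub>m ?r ?r"
    by (rule embed_block_inject[OF Ac, of _ 0 0]) (use A0 cs(4,5) in \<open>auto simp: A'_def embed_block_zero\<close>)
  moreover have "C = 0\<^sub>m (?p - ?r) (?p - ?r)"
    by (rule embed_block_inject[OF Cc, of _ ?r ?r]) (use C0 cs(4,5) in \<open>auto simp: C'_def embed_block_zero\<close>)
  ultimately show "A = 0\<^sub>m ?r ?r \<and> C = 0\<^sub>m (?p - ?r) (?p - ?r)" ..
qed

text \<open>
  Another solution has the form \<open>U P W\<close> with \<open>P\<close> positive semidefinite, and the blocks of \<open>P - D\<close>
  solve the system of the implication.
\<close>

lemma unique_if_certificate_implication:
  fixes \<Phi> :: "('n1::{finite,linorder}, 'n2::{finite,linorder}) rmat \<Rightarrow> real^'m"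
  assumes le: "CARD('n1) \<le> CARD('n2)" and lin: "linear \<Phi>" and Y: "Y \<in> certificate_set \<Phi> X0"
    and imp: "certificate_implication \<Phi> X0 Y"
    and \<Phi>X: "\<Phi> X = \<Phi> X0" and nn: "nuclear_norm X \<le> nuclear_norm X0"
  shows "X = X0"
proof -
  let ?r = "rank X0" and ?p = "num_unit_singular_values Y"
  have Ys: "Y \<in> subdifferential nuclear_norm X0" and Yr: "Y \<in> range (adjoint \<Phi>)"
    using Y by (auto simp: certificate_set_def)
  note cY = subdifferential_nuclear_norm[OF le Ys]
  obtain U V where UVX: "(U, V) \<in> ordered_SVDs X0" and UVY: "(U, V) \<in> ordered_SVDs Y"
    using ex_simultaneous_ordered_SVD[OF le cY] by auto
  note cs = certificate_structure[OF le Ys UVX UVY]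
  define W where "W = (rect_id :: ('n1, 'n2) rmat) ** transpose V"
  have oU: "orthogonal_matrix U" and oV: "orthogonal_matrix V"
    and X0: "X0 = U ** diagm (sv_vec X0) ** W" and Y': "Y = U ** diagm (sv_vec Y) ** W"
    using UVX UVY by (auto simp: ordered_SVDs_iff W_def)
  have W: "W ** transpose W = id_mat"
    unfolding W_def by (rule thin_coisometry[OF le oV])
  have "X \<bullet> Y = X0 \<bullet> Y" by (rule inner_range_adjoint[OF lin Yr \<Phi>X])
  then have "X \<bullet> Y = nuclear_norm X" using cY(2) nn inner_le_nuclear_norm[OF le cY(1), of X] by simp
  then obtain P where P: "psd P" "X = U ** P ** W"
    "\<And>i j. P $ i $ j \<noteq> 0 \<Longrightarrow> sv_vec Y $ i = 1 \<and> sv_vec Y $ j = 1"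
    using nuclear_norm_face[OF le oU W Y' ex_ordered_SVD_props(2)[OF le] cs(3) cY(1)] by metis
  define I where "I = {i :: 'n1. pos i < ?r}"
  define J where "J = {i :: 'n1. ?r \<le> pos i \<and> pos i < ?p}"
  have IJ: "I \<inter> J = {}" by (auto simp: I_def J_def)
  have supp: "i \<in> I \<union> J \<and> j \<in> I \<union> J" if "P $ i $ j \<noteq> 0" for i j
    using P(3)[OF that] cs(2) by (auto simp: I_def J_def)
  \<comment> \<open>\<open>X\<close> and \<open>X0\<close> correspond to \<open>P\<close> and \<open>diagm (sv_vec X0)\<close>; their difference is a
    block matrix of the kind in the implication.\<close>
  obtain B' C' where C': "psd C'" "coord_proj J ** C' ** coord_proj J = C'"
    and B': "coord_proj I ** B' ** coord_proj J = B'"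
    and Peq: "P = coord_proj I ** P ** coord_proj I + B' ** C' + transpose (B' ** C') + C'"
    using psd_block_factor[OF P(1) IJ supp] by metis
  define A' where "A' = coord_proj I ** P ** coord_proj I - diagm (sv_vec X0)"
  define A where "A = cut_block 0 0 ?r ?r A'"
  define B where "B = cut_block 0 ?r ?r (?p - ?r) B'"
  define C where "C = cut_block ?r ?r (?p - ?r) (?p - ?r) C'"
  have A'supp: "i \<in> I \<and> j \<in> I" if "A' $ i $ j \<noteq> 0" for i j
    using that cs(1)[of i] ex_ordered_SVD_props(2)[OF le, where X=X0 and i=i]
    by (auto simp: A'_def coord_proj_entries diagm_def I_def split: if_splits)
  have eA: "embed_block 0 0 A = A'"
    unfolding A_def by (rule embed_cut_block) (use A'supp in \<open>auto simp: I_def\<close>)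
  have eB: "embed_block 0 ?r B = B'"
    unfolding B_def by (rule embed_cut_block) (use B'[unfolded coord_proj_absorb] cs(4) in \<open>auto simp: I_def J_def\<close>)
  have eC: "embed_block ?r ?r C = C'"
    unfolding C_def by (rule embed_cut_block) (use C'(2)[unfolded coord_proj_absorb] cs(4) in \<open>auto simp: J_def\<close>)
  have Ac: "A \<in> carrier_mat ?r ?r" and Bc: "B \<in> carrier_mat ?r (?p - ?r)" and Cc: "C \<in> carrier_mat (?p - ?r) (?p - ?r)"
    by (simp_all add: A_def B_def C_def cut_block_def)
  have "transpose P = P" using P(1) by (simp add: psd_def)
  then have "transpose A' = A'"
    by (auto simp: A'_def vec_eq_iff transpose_def coord_proj_entries diagm_def)
  then have "transpose_mat A = A"
    by (intro embed_block_inject[of "transpose_mat A" ?r ?r A 0 0, where 'n='n1])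
      (use Ac cs(4,5) in \<open>auto simp: transpose_embed_block[symmetric] eA\<close>)
  then have Am: "A \<in> sym_mats ?r" using Ac by (simp add: sym_mats_def)
  have Cm: "C \<in> psd_mats (?p - ?r)"
    using psd_mats_iff_psd_embed_block[OF Cc, of ?r, where 'n='n1] C'(1) cs(4,5) by (simp add: eC)
  define K where "K = A' + B' ** C' + transpose (B' ** C') + C'"
  have K: "P = diagm (sv_vec X0) + K" unfolding K_def A'_def by (subst (1) Peq) simp
  have blk: "of_jnf_mat (certificate_block CARD('n1) CARD('n2) ?p A B C) = K ** (rect_id :: ('n1, 'n2) rmat)"
    using of_jnf_certificate_block[OF le cs(4,5) Ac Bc Cc] by (simp add: K_def eA eB eC)
  have "X = X0 + U ** K ** W"
    using matrix_mult_affine[of U "diagm (sv_vec X0)" 1 K W] unfolding P(2) K X0[symmetric] by simp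
  then have XK: "U ** K ** W = X - X0" by simp
  have "\<Phi> (U ** of_jnf_mat (certificate_block CARD('n1) CARD('n2) ?p A B C) ** transpose V) = \<Phi> (U ** K ** W)"
    unfolding blk W_def by (simp add: matrix_mul_assoc)
  also have "\<dots> = 0" unfolding XK using lin \<Phi>X by (simp add: linear_diff)
  finally have "A = 0\<^sub>m ?r ?r \<and> C = 0\<^sub>m (?p - ?r) (?p - ?r)"
    using imp UVX UVY Am Bc Cm unfolding certificate_implication_def Let_def by blast
  then have "A' = 0" "C' = 0" using eA eC by (auto simp: embed_block_zero)
  then have "K = 0" by (simp add: K_def vec_eq_iff transpose_def matrix_matrix_mult_def)
  then show ?thesis using XK by (simp add: vec_eq_iff matrix_matrix_mult_def)
qed

theorem corollary4p8:
  fixes \<Phi> :: "real^('n2::{finite,linorder})^('n1::{finite,linorder}) \<Rightarrow> real^'m"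
    and M0 :: "real^'m"
    and X0 :: "real^('n2::{finite,linorder})^('n1::{finite,linorder})"
  assumes "CARD('n1) \<le> CARD('n2)"
    and "linear \<Phi>"
    and "is_arg_min nuclear_norm (\<lambda>X. \<Phi> X = M0) X0"
  shows "({X. is_arg_min nuclear_norm (\<lambda>X. \<Phi> X = M0) X} = {X0}
            \<longleftrightarrow> (\<forall>Y \<in> certificate_set \<Phi> X0. certificate_implication \<Phi> X0 Y))
       \<and> ({X. is_arg_min nuclear_norm (\<lambda>X. \<Phi> X = M0) X} = {X0}
            \<longleftrightarrow> (\<exists>Y \<in> certificate_set \<Phi> X0. certificate_implication \<Phi> X0 Y))"
proof -
  note le = assms(1) and lin = assms(2)
  have X0: "\<Phi> X0 = M0" and min: "\<And>X. \<Phi> X = M0 \<Longrightarrow> nuclear_norm X0 \<le> nuclear_norm X"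
    using assms(3) by (auto simp: is_arg_min_linorder)
  have "{X. is_arg_min nuclear_norm (\<lambda>X. \<Phi> X = M0) X} = {X. \<Phi> X = \<Phi> X0 \<and> nuclear_norm X \<le> nuclear_norm X0}"
    using X0 min by (auto simp: is_arg_min_linorder intro: order_trans)
  then have uniq: "{X. is_arg_min nuclear_norm (\<lambda>X. \<Phi> X = M0) X} = {X0} \<longleftrightarrow>
      (\<forall>X. \<Phi> X = \<Phi> X0 \<longrightarrow> nuclear_norm X \<le> nuclear_norm X0 \<longrightarrow> X = X0)"
    by auto
  have "certificate_set \<Phi> X0 \<noteq> {}"
    unfolding certificate_set_def
    by (rule ex_dual_certificate[OF convex_on_nuclear_norm[OF le] lin]) (use X0 min in auto)
  then show ?thesis
    unfolding uniq
    using certificate_implication_if_unique[OF le lin, of _ X0]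
      unique_if_certificate_implication[OF le lin, of _ X0]
    by blast
qed

end
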